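(* Let $n\ge 2$ and $\sigma,\tau>0$, and consider the global game with noisy information sharing with $n$ agents and noise parameters $\sigma^2,\tau^2$ (defined in the context). For each $i\in[n]$ let $\bar\theta_i(y_i)=E[\theta\mid y_i]$. Then there do not exist threshold values $t_1,\dots,t_n\in\mathbb{R}$ such that the strategy profile $(1_{\bar\theta_1(y_1)\le t_1},\dots,1_{\bar\theta_n(y_n)\le t_n})$ is a Bayesian Nash equilibrium.
   Context: Global game with noisy information sharing. There are $n$ agents $[n]=\{1,\dots,n\}$, each with action set $\{0,1\}$ ($1$ = risky, $0$ = safe). Under action profile $\alpha\in\{0,1\}^n$ the utility of agent $i$ is $u_i(\alpha)=\alpha_i\big(\sum_{j=1}^n\alpha_j-\theta\big)$. The fundamental $\theta$ is uniformly distributed over $\mathbb{R}$ (improper flat prior). Let $x_i=\theta+\xi_i$ for $i\in[n]$ and $y_{ji}=x_j+\zeta_{ji}$ for $j\ne i$, where $\xi_1,\dots,\xi_n$ are i.i.d. $\mathcal N(0,\sigma^2)$ and the $\zeta_{ji}$ are i.i.d. $\mathcal N(0,\tau^2)$, independent of the $\xi$'s (all noises independent of $\theta$). Agent $i$ observes the vector $y_i=(x_i,\{y_{ji}\}_{j\in[n]\setminus\{i\}})\in\mathbb{R}^n$ (families indexed by agents are listed in increasing order of the index). Because the prior is improper, conditional laws, probabilities and expectations given $y_i=u$ are formal posteriors: one takes the $\sigma$-finite measure under which $\theta$ has Lebesgue measure and the noises have the stated laws, and conditions on $y_i=u$ by normalizing the joint density (this gives proper Gaussian laws). A strategy of agent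 $i$ is a measurable function $s_i:\mathbb{R}^n\to\{0,1\}$, applied to $y_i$. A strategy $\tilde s$ is a best response of agent $i$ to $(s_j)_{j\ne i}$ if for every $u\in\mathbb{R}^n$: $\tilde s(u)=0$ whenever $1+E[\sum_{j\ne i}s_j(y_j)\mid y_i=u]<E[\theta\mid y_i=u]$, and $\tilde s(u)=1$ whenever $1+E[\sum_{j\ne i}s_j(y_j)\mid y_i=u]>E[\theta\mid y_i=u]$. A profile $(s_1,\dots,s_n)$ is a Bayesian Nash equilibrium if each $s_i$ is a best response to $(s_j)_{j\neq i}$. *)

theory Defs
  imports "HOL-Probability.Probability"
begin

text \<open>
  Agents are \<open>1, \<dots>, n\<close>.  A vector in \<open>\<real>\<^sup>n\<close> is a point of the finite product space
  \<open>\<Pi>\<^sub>M p\<in>{1..n}. lborel\<close>.  The observation of agent \<open>i\<close> has its own signal \<open>x\<^sub>i\<close> at position 1,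
  followed by \<open>y\<^sub>j\<^sub>i\<close> for \<open>j \<noteq> i\<close> in increasing order of \<open>j\<close>; \<open>source i p\<close> is the agent whose
  signal is reported at position \<open>p\<close>.
\<close>

definition obs_space :: "nat \<Rightarrow> (nat \<Rightarrow> real) measure" where
  "obs_space n = (\<Pi>\<^sub>M p\<in>{1..n}. lborel)"

definition source :: "nat \<Rightarrow> nat \<Rightarrow> nat" where
  "source i p = (if p = 1 then i else if p \<le> i then p - 1 else p)"

text \<open>
  The \<open>\<sigma>\<close>-finite measure on states \<open>(\<theta>, \<xi>, \<zeta>)\<close>: Lebesgue measure for \<open>\<theta>\<close>, independent Gaussian noises.
  Note that the second parameter of \<^const>\<open>normal_density\<close> is the standard deviation.
\<close>

type_synonym state = "real \<times> (nat \<Rightarrow> real) \<times> (nat \<times> nat \<Rightarrow> real)"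

definition links :: "nat \<Rightarrow> (nat \<times> nat) set" where
  "links n = {(j, i). j \<in> {1..n} \<and> i \<in> {1..n} \<and> j \<noteq> i}"

definition game_measure :: "nat \<Rightarrow> real \<Rightarrow> real \<Rightarrow> state measure" where
  "game_measure n \<sigma> \<tau> =
     lborel \<Otimes>\<^sub>M (\<Pi>\<^sub>M i\<in>{1..n}. density lborel (normal_density 0 \<sigma>))
            \<Otimes>\<^sub>M (\<Pi>\<^sub>M l\<in>links n. density lborel (normal_density 0 \<tau>))"

fun fundamental :: "state \<Rightarrow> real" where
  "fundamental (\<theta>, \<xi>, \<zeta>) = \<theta>"

fun private_signal :: "nat \<Rightarrow> state \<Rightarrow> real" where
  "private_signal i (\<theta>, \<xi>, \<zeta>) = \<theta> + \<xi> i"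

fun shared_signal :: "nat \<Rightarrow> nat \<Rightarrow> state \<Rightarrow> real" where
  "shared_signal j i (\<theta>, \<xi>, \<zeta>) = private_signal j (\<theta>, \<xi>, \<zeta>) + \<zeta> (j, i)"

definition observation :: "nat \<Rightarrow> nat \<Rightarrow> state \<Rightarrow> (nat \<Rightarrow> real)" where
  "observation n i \<omega> =
     (\<lambda>p\<in>{1..n}. if p = 1 then private_signal i \<omega> else shared_signal (source i p) i \<omega>)"

text \<open>
  The joint density of \<open>(\<theta>, y\<^sub>1, \<dots>, y\<^sub>n)\<close> with respect to Lebesgue measure.  That it is the density of
  the law of these variables under \<^const>\<open>game_measure\<close> is lemma \<open>distributed_joint_density\<close> below;
  we fix this continuous version, so that conditioning on \<open>y\<^sub>i = u\<close> makes sense for every \<open>u\<close>.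
\<close>

definition joint_density :: "nat \<Rightarrow> real \<Rightarrow> real \<Rightarrow> real \<Rightarrow> (nat \<Rightarrow> nat \<Rightarrow> real) \<Rightarrow> real" where
  "joint_density n \<sigma> \<tau> \<theta> Y =
     (\<Prod>k\<in>{1..n}. normal_density \<theta> \<sigma> (Y k 1)) *
     (\<Prod>k\<in>{1..n}. \<Prod>p\<in>{2..n}. normal_density (Y (source k p) 1) \<tau> (Y k p))"

text \<open>
  The conditional law of \<open>(\<theta>, (y\<^sub>j)\<^sub>j\<^sub>\<noteq>\<^sub>i)\<close> given \<open>y\<^sub>i = u\<close>: the section of the joint density at
  \<open>y\<^sub>i = u\<close>, normalized.
\<close>

definition posterior ::
  "nat \<Rightarrow> real \<Rightarrow> real \<Rightarrow> nat \<Rightarrow> (nat \<Rightarrow> real) \<Rightarrow> (real \<times> (nat \<Rightarrow> nat \<Rightarrow> real)) measure" where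
  "posterior n \<sigma> \<tau> i u =
     (let B = lborel \<Otimes>\<^sub>M (\<Pi>\<^sub>M j\<in>{1..n} - {i}. obs_space n);
          f = (\<lambda>(\<theta>, Y). ennreal (joint_density n \<sigma> \<tau> \<theta> (Y(i := u))))
      in density B (\<lambda>z. f z / (\<integral>\<^sup>+ z. f z \<partial>B)))"

definition posterior_mean :: "nat \<Rightarrow> real \<Rightarrow> real \<Rightarrow> nat \<Rightarrow> (nat \<Rightarrow> real) \<Rightarrow> real" where
  "posterior_mean n \<sigma> \<tau> i u = (\<integral>z. fst z \<partial>posterior n \<sigma> \<tau> i u)"

text \<open>Strategies take the values 0 (safe) and 1 (risky).\<close>

type_synonym strategy = "(nat \<Rightarrow> real) \<Rightarrow> nat"

definition is_strategy :: "nat \<Rightarrow> strategy \<Rightarrow> bool" where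
  "is_strategy n s \<longleftrightarrow> s \<in> obs_space n \<rightarrow>\<^sub>M count_space {0, 1}"

definition expected_others ::
  "nat \<Rightarrow> real \<Rightarrow> real \<Rightarrow> (nat \<Rightarrow> strategy) \<Rightarrow> nat \<Rightarrow> (nat \<Rightarrow> real) \<Rightarrow> real" where
  "expected_others n \<sigma> \<tau> s i u =
     (\<integral>z. (\<Sum>j\<in>{1..n} - {i}. real (s j (snd z j))) \<partial>posterior n \<sigma> \<tau> i u)"

text \<open>
  With utility \<open>u\<^sub>i(\<alpha>) = \<alpha>\<^sub>i (\<Sum>\<^sub>j \<alpha>\<^sub>j - \<theta>)\<close>, the safe action yields 0 and the risky action yields
  \<open>1 + \<Sum>\<^sub>j\<^sub>\<noteq>\<^sub>i \<alpha>\<^sub>j - \<theta>\<close>.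
\<close>

definition best_response ::
  "nat \<Rightarrow> real \<Rightarrow> real \<Rightarrow> nat \<Rightarrow> strategy \<Rightarrow> (nat \<Rightarrow> strategy) \<Rightarrow> bool" where
  "best_response n \<sigma> \<tau> i s' s \<longleftrightarrow>
     is_strategy n s' \<and>
     (\<forall>u\<in>space (obs_space n).
        (1 + expected_others n \<sigma> \<tau> s i u < posterior_mean n \<sigma> \<tau> i u \<longrightarrow> s' u = 0) \<and>
        (1 + expected_others n \<sigma> \<tau> s i u > posterior_mean n \<sigma> \<tau> i u \<longrightarrow> s' u = 1))"

definition bayes_nash_equilibrium ::
  "nat \<Rightarrow> real \<Rightarrow> real \<Rightarrow> (nat \<Rightarrow> strategy) \<Rightarrow> bool" where
  "bayes_nash_equilibrium n \<sigma> \<tau> s \<longleftrightarrow> (\<forall>i\<in>{1..n}. best_response n \<sigma> \<tau> i (s i) s)"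

lemma source_order:
  assumes "i \<in> {1..n}"
  shows "map (source i) [1..<Suc n] = i # sorted_list_of_set ({1..n} - {i})"
proof -
  have inj: "inj_on (source i) {2..n}"
    by (auto simp: inj_on_def source_def split: if_splits)
  have img: "source i ` {2..n} = {1..n} - {i}"
  proof (intro equalityI subsetI)
    fix j assume "j \<in> {1..n} - {i}"
    then have "j = source i (if j < i then j + 1 else j)" "(if j < i then j + 1 else j) \<in> {2..n}"
      using assms by (auto simp: source_def)
    then show "j \<in> source i ` {2..n}" by blast
  qed (use assms in \<open>auto simp: source_def\<close>)
  have "sorted_list_of_set ({1..n} - {i}) = map (source i) [2..<Suc n]"
  proof (rule sorted_distinct_set_unique)
    have "sorted_wrt (\<lambda>p q. source i p \<le> source i q) [2..<Suc n]"
      by (rule sorted_wrt_mono_rel[of _ "(<)"]) (auto simp: source_def simp del: upt_Suc)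
    then show "sorted (map (source i) [2..<Suc n])"
      by (simp add: sorted_wrt_map)
    show "distinct (map (source i) [2..<Suc n])"
      using inj by (simp add: distinct_map atLeastLessThanSuc_atLeastAtMost del: upt_Suc)
    show "set (sorted_list_of_set ({1..n} - {i})) = set (map (source i) [2..<Suc n])"
      using img by (simp add: atLeastLessThanSuc_atLeastAtMost del: upt_Suc)
  qed simp_all
  moreover have "[1..<Suc n] = 1 # [2..<Suc n]"
    using assms by (subst upt_conv_Cons) (auto simp: numeral_2_eq_2)
  ultimately show ?thesis by (simp add: source_def)
qed

lemma bij_betw_source:
  "bij_betw (\<lambda>(k, p). (source k p, k)) ({1..n} \<times> {2..n}) (links n)"
proof -
  have "inj_on (\<lambda>(k, p). (source k p, k)) ({1..n} \<times> {2..n})"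
    by (auto simp: inj_on_def source_def split: if_splits)
  moreover have "(\<lambda>(k, p). (source k p, k)) ` ({1..n} \<times> {2..n}) = links n"
  proof (intro equalityI subsetI)
    fix l assume "l \<in> links n"
    then obtain j i where l: "l = (j, i)" "j \<in> {1..n}" "i \<in> {1..n}" "j \<noteq> i"
      by (auto simp: links_def)
    then have "l = (\<lambda>(k, p). (source k p, k)) (i, if j < i then j + 1 else j)"
      "(i, if j < i then j + 1 else j) \<in> {1..n} \<times> {2..n}"
      by (auto simp: source_def)
    then show "l \<in> (\<lambda>(k, p). (source k p, k)) ` ({1..n} \<times> {2..n})" by blast
  qed (auto simp: source_def links_def split: if_splits)
  ultimately show ?thesis by (simp add: bij_betw_def)
qed

lemma bij_betw_source_full:
  "bij_betw (\<lambda>(k, p). (source k p, k)) ({1..n} \<times> {1..n}) ({1..n} \<times> {1..n})"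
proof -
  have "inj_on (\<lambda>(k, p). (source k p, k)) ({1..n} \<times> {1..n})"
    by (auto simp: inj_on_def source_def split: if_splits)
  moreover have "(\<lambda>(k, p). (source k p, k)) ` ({1..n} \<times> {1..n}) \<subseteq> {1..n} \<times> {1..n}"
    by (auto simp: source_def)
  ultimately show ?thesis
    by (simp add: bij_betw_def endo_inj_surj)
qed

lemma finite_links: "finite (links n)"
  by (rule finite_subset[of _ "{1..n} \<times> {1..n}"]) (auto simp: links_def)

lemma product_sigma_finite_lborel: "product_sigma_finite (\<lambda>_. (lborel :: real measure))"
  by unfold_locales

lemma product_sigma_finite_normal:
  assumes "s > 0"
  shows "product_sigma_finite (\<lambda>i. density lborel (normal_density (m i) s))"
  unfolding product_sigma_finite_def
  using prob_space_normal_density[OF assms] prob_space_imp_sigma_finite by blast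

lemma emeasure_shifted_normal:
  assumes "s > 0" "A \<in> sets lborel"
  shows "emeasure (density lborel (normal_density 0 s)) ((\<lambda>x. m + x) -` A) =
         emeasure (density lborel (normal_density m s)) A"
proof -
  have [measurable]: "A \<in> sets borel" using assms by simp
  have "(\<lambda>x. m + x) -` A \<in> sets borel"
    by (rule measurable_sets_borel[OF _ \<open>A \<in> sets borel\<close>]) simp
  then have "emeasure (density lborel (normal_density 0 s)) ((\<lambda>x. m + x) -` A) =
      (\<integral>\<^sup>+x. ennreal (normal_density 0 s x) * indicator A (m + x) \<partial>lborel)"
    by (subst emeasure_density) (auto simp: indicator_def intro!: nn_integral_cong)
  also have "\<dots> = (\<integral>\<^sup>+x. ennreal (normal_density m s x) * indicator A x
      \<partial>distr lborel borel (\<lambda>x. m + x))"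
    by (subst nn_integral_distr) (auto simp: normal_density_def)
  also have "\<dots> = emeasure (density lborel (normal_density m s)) A"
    using lborel_distr_plus[of m] by (simp add: emeasure_density)
  finally show ?thesis .
qed

lemma nn_integral_shifted_normals:
  fixes m :: "'i \<Rightarrow> real"
  assumes "finite I" "s > 0" and [measurable]: "h \<in> borel_measurable (\<Pi>\<^sub>M i\<in>I. lborel)"
  shows "(\<integral>\<^sup>+x. h (\<lambda>i\<in>I. m i + x i) \<partial>(\<Pi>\<^sub>M i\<in>I. density lborel (normal_density 0 s))) =
         (\<integral>\<^sup>+x. ennreal (\<Prod>i\<in>I. normal_density (m i) s (x i)) * h x \<partial>(\<Pi>\<^sub>M i\<in>I. lborel))"
proof -
  interpret L: product_sigma_finite "\<lambda>_. lborel :: real measure"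
    by (rule product_sigma_finite_lborel)
  interpret N0: product_sigma_finite "\<lambda>_::'i. density lborel (normal_density 0 s)"
    using product_sigma_finite_normal[OF assms(2), of "\<lambda>_. 0"] .
  interpret N: product_sigma_finite "\<lambda>i::'i. density lborel (normal_density (m i) s)"
    using product_sigma_finite_normal[OF assms(2)] .
  let ?P = "\<Pi>\<^sub>M i\<in>I. (lborel :: real measure)"
  have sets0: "sets (\<Pi>\<^sub>M i\<in>I. density lborel (normal_density 0 s)) = sets ?P"
    by (intro sets_PiM_cong) auto
  have [measurable]: "(\<lambda>x. \<lambda>i\<in>I. m i + x i) \<in> ?P \<rightarrow>\<^sub>M ?P"
    by measurable
  have meas: "(\<lambda>x. \<lambda>i\<in>I. m i + x i) \<in> (\<Pi>\<^sub>M i\<in>I. density lborel (normal_density 0 s)) \<rightarrow>\<^sub>M ?P"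
    by (simp add: measurable_cong_sets[OF sets0 refl])
  have dens [measurable]: "(\<lambda>x. ennreal (\<Prod>i\<in>I. normal_density (m i) s (x i))) \<in> borel_measurable ?P"
    by measurable
  have 1: "distr (\<Pi>\<^sub>M i\<in>I. density lborel (normal_density 0 s)) ?P (\<lambda>x. \<lambda>i\<in>I. m i + x i) =
      (\<Pi>\<^sub>M i\<in>I. density lborel (normal_density (m i) s))"
  proof (rule N.PiM_eqI)
    show "finite I" by fact
    show "sets (distr (\<Pi>\<^sub>M i\<in>I. density lborel (normal_density 0 s)) ?P (\<lambda>x. \<lambda>i\<in>I. m i + x i)) =
      sets (\<Pi>\<^sub>M i\<in>I. density lborel (normal_density (m i) s))"
      by (simp, intro sets_PiM_cong) auto
    fix A assume A: "\<And>i. i \<in> I \<Longrightarrow> A i \<in> sets (density lborel (normal_density (m i) s))"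
    then have A': "A i \<in> sets lborel" if "i \<in> I" for i using that by simp
    have eq: "(\<lambda>x. \<lambda>i\<in>I. m i + x i) -` Pi\<^sub>E I A \<inter> space (\<Pi>\<^sub>M i\<in>I. density lborel (normal_density 0 s))
       = Pi\<^sub>E I (\<lambda>i. (\<lambda>x. m i + x) -` A i)"
      by (auto simp: space_PiM PiE_iff)
    have "emeasure (distr (\<Pi>\<^sub>M i\<in>I. density lborel (normal_density 0 s)) ?P
        (\<lambda>x. \<lambda>i\<in>I. m i + x i)) (Pi\<^sub>E I A) =
        (\<Prod>i\<in>I. emeasure (density lborel (normal_density 0 s)) ((\<lambda>x. m i + x) -` A i))"
      using A' \<open>finite I\<close>
      apply (subst emeasure_distr[OF meas])
       apply (intro sets_PiM_I_finite, simp_all add: eq)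
      apply (subst N0.emeasure_PiM)
        apply (auto intro!: measurable_sets_borel[of "(+) _" borel])
      done
    also have "\<dots> = (\<Prod>i\<in>I. emeasure (density lborel (normal_density (m i) s)) (A i))"
      using A' assms(2) by (intro prod.cong emeasure_shifted_normal) auto
    finally show "emeasure (distr (\<Pi>\<^sub>M i\<in>I. density lborel (normal_density 0 s)) ?P
        (\<lambda>x. \<lambda>i\<in>I. m i + x i)) (Pi\<^sub>E I A) = \<dots>" .
  qed
  have 2: "density ?P (\<lambda>x. ennreal (\<Prod>i\<in>I. normal_density (m i) s (x i))) =
      (\<Pi>\<^sub>M i\<in>I. density lborel (normal_density (m i) s))"
  proof (rule N.PiM_eqI)
    show "finite I" by fact
    show "sets (density ?P (\<lambda>x. ennreal (\<Prod>i\<in>I. normal_density (m i) s (x i)))) =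
      sets (\<Pi>\<^sub>M i\<in>I. density lborel (normal_density (m i) s))"
      by (simp, intro sets_PiM_cong) auto
    fix A assume A: "\<And>i. i \<in> I \<Longrightarrow> A i \<in> sets (density lborel (normal_density (m i) s))"
    then have A': "A i \<in> sets borel" if "i \<in> I" for i using that by simp
    have "emeasure (density ?P (\<lambda>x. ennreal (\<Prod>i\<in>I. normal_density (m i) s (x i)))) (Pi\<^sub>E I A) =
      (\<integral>\<^sup>+x. ennreal (\<Prod>i\<in>I. normal_density (m i) s (x i)) * indicator (Pi\<^sub>E I A) x \<partial>?P)"
      using A' \<open>finite I\<close> by (intro emeasure_density dens sets_PiM_I_finite) auto
    also have "\<dots> = (\<integral>\<^sup>+x. (\<Prod>i\<in>I. ennreal (normal_density (m i) s (x i)) * indicator (A i) (x i)) \<partial>?P)"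
    proof (intro nn_integral_cong)
      fix x assume "x \<in> space ?P"
      then have "indicator (Pi\<^sub>E I A) x = (\<Prod>i\<in>I. indicator (A i) (x i) :: ennreal)"
        using \<open>finite I\<close> by (auto simp: indicator_def space_PiM PiE_iff prod_zero_iff)
      then show "ennreal (\<Prod>i\<in>I. normal_density (m i) s (x i)) * indicator (Pi\<^sub>E I A) x =
          (\<Prod>i\<in>I. ennreal (normal_density (m i) s (x i)) * indicator (A i) (x i))"
        by (simp add: prod.distrib prod_ennreal)
    qed
    also have "\<dots> = (\<Prod>i\<in>I. \<integral>\<^sup>+x. ennreal (normal_density (m i) s x) * indicator (A i) x \<partial>lborel)"
      using A' \<open>finite I\<close> by (intro L.product_nn_integral_prod) auto
    also have "\<dots> = (\<Prod>i\<in>I. emeasure (density lborel (normal_density (m i) s)) (A i))"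
      using A' by (intro prod.cong) (auto simp: emeasure_density)
    finally show "emeasure (density ?P (\<lambda>x. ennreal (\<Prod>i\<in>I. normal_density (m i) s (x i)))) (Pi\<^sub>E I A)
      = \<dots>" .
  qed
  have "(\<integral>\<^sup>+x. h (\<lambda>i\<in>I. m i + x i) \<partial>(\<Pi>\<^sub>M i\<in>I. density lborel (normal_density 0 s))) =
      (\<integral>\<^sup>+x. h x \<partial>distr (\<Pi>\<^sub>M i\<in>I. density lborel (normal_density 0 s)) ?P (\<lambda>x. \<lambda>i\<in>I. m i + x i))"
    by (subst nn_integral_distr[OF meas]) auto
  also have "\<dots> = (\<integral>\<^sup>+x. h x \<partial>density ?P (\<lambda>x. ennreal (\<Prod>i\<in>I. normal_density (m i) s (x i))))"
    by (simp only: 1 2)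
  also have "\<dots> = (\<integral>\<^sup>+x. ennreal (\<Prod>i\<in>I. normal_density (m i) s (x i)) * h x \<partial>?P)"
    by (rule nn_integral_density[OF dens]) simp
  finally show ?thesis .
qed

lemma nn_integral_PiM_reindex:
  fixes I :: "'i set" and J :: "'j set"
  assumes "finite J" "bij_betw b I J" and [measurable]: "h \<in> borel_measurable (\<Pi>\<^sub>M i\<in>I. lborel)"
  shows "(\<integral>\<^sup>+x. h (\<lambda>i\<in>I. x (b i)) \<partial>(\<Pi>\<^sub>M j\<in>J. lborel)) = (\<integral>\<^sup>+x. h x \<partial>(\<Pi>\<^sub>M i\<in>I. (lborel :: real measure)))"
proof -
  interpret LI: product_sigma_finite "\<lambda>_::'i. (lborel :: real measure)"
    by (rule product_sigma_finite_lborel)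
  interpret LJ: product_sigma_finite "\<lambda>_::'j. (lborel :: real measure)"
    by (rule product_sigma_finite_lborel)
  have bI: "b i \<in> J" if "i \<in> I" for i using that assms(2) by (auto simp: bij_betw_def)
  have finI: "finite I" using assms(1,2) bij_betw_finite by blast
  have meas: "(\<lambda>x. \<lambda>i\<in>I. x (b i)) \<in> (\<Pi>\<^sub>M j\<in>J. lborel) \<rightarrow>\<^sub>M (\<Pi>\<^sub>M i\<in>I. (lborel :: real measure))"
    using bI by (intro measurable_restrict measurable_component_singleton)
  have "distr (\<Pi>\<^sub>M j\<in>J. lborel) (\<Pi>\<^sub>M i\<in>I. (lborel :: real measure)) (\<lambda>x. \<lambda>i\<in>I. x (b i)) =
      (\<Pi>\<^sub>M i\<in>I. lborel)"
  proof (rule LI.PiM_eqI)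
    fix A :: "'i \<Rightarrow> real set" assume A: "\<And>i. i \<in> I \<Longrightarrow> A i \<in> sets lborel"
    define b' where "b' = inv_into I b"
    have b': "b' j \<in> I" "b (b' j) = j" if "j \<in> J" for j
      using assms(2) that unfolding b'_def
      by (auto simp: bij_betw_def inv_into_into f_inv_into_f)
    have b'b: "b' (b i) = i" if "i \<in> I" for i
      using assms(2) that by (simp add: b'_def bij_betw_def)
    have "(\<forall>i\<in>I. x (b i) \<in> A i) \<longleftrightarrow> (\<forall>j\<in>J. x j \<in> A (b' j))" for x
      using bI b' b'b by metis
    then have eq: "(\<lambda>x. \<lambda>i\<in>I. x (b i)) -` Pi\<^sub>E I A \<inter> space (\<Pi>\<^sub>M j\<in>J. lborel) = Pi\<^sub>E J (\<lambda>j. A (b' j))"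
      by (auto simp: space_PiM PiE_iff)
    have "emeasure (distr (\<Pi>\<^sub>M j\<in>J. lborel) (\<Pi>\<^sub>M i\<in>I. (lborel :: real measure))
        (\<lambda>x. \<lambda>i\<in>I. x (b i))) (Pi\<^sub>E I A) = emeasure (\<Pi>\<^sub>M j\<in>J. lborel) (Pi\<^sub>E J (\<lambda>j. A (b' j)))"
      unfolding eq[symmetric] using finI A
      by (intro emeasure_distr[OF meas] sets_PiM_I_finite)
    also have "\<dots> = (\<Prod>j\<in>J. emeasure lborel (A (b' j)))"
      using A b' assms(1) by (intro LJ.emeasure_PiM) auto
    also have "\<dots> = (\<Prod>i\<in>I. emeasure lborel (A i))"
      using b'b by (subst prod.reindex_bij_betw[OF assms(2), symmetric]) (auto intro!: prod.cong)
    finally show "emeasure (distr (\<Pi>\<^sub>M j\<in>J. lborel) (\<Pi>\<^sub>M i\<in>I. (lborel :: real measure))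
        (\<lambda>x. \<lambda>i\<in>I. x (b i))) (Pi\<^sub>E I A) = \<dots>" .
  qed (use finI in simp_all)
  then show ?thesis
    using nn_integral_distr[OF meas, of h] by simp
qed

lemma nn_integral_PiM_curry:
  fixes K :: "'k set" and P :: "'p set"
  assumes "finite K" "finite P"
    and "h \<in> borel_measurable (\<Pi>\<^sub>M k\<in>K. \<Pi>\<^sub>M p\<in>P. (lborel :: real measure))"
  shows "(\<integral>\<^sup>+w. h (\<lambda>k\<in>K. \<lambda>p\<in>P. w (k, p)) \<partial>(\<Pi>\<^sub>M l\<in>K \<times> P. lborel)) =
         (\<integral>\<^sup>+Y. h Y \<partial>(\<Pi>\<^sub>M k\<in>K. \<Pi>\<^sub>M p\<in>P. lborel))"
  using assms(1,3)
proof (induction K arbitrary: h rule: finite_induct)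
  case empty
  then show ?case by (simp add: PiM_empty nn_integral_count_space_finite)
next
  case (insert k K)
  interpret L: product_sigma_finite "\<lambda>_::'k \<times> 'p. (lborel :: real measure)"
    by (rule product_sigma_finite_lborel)
  let ?L = "\<Pi>\<^sub>M p\<in>P. (lborel :: real measure)"
  have sfP: "sigma_finite_measure ?L"
    by (intro product_sigma_finite.sigma_finite product_sigma_finite_lborel assms(2))
  interpret O: product_sigma_finite "\<lambda>_::'k. ?L"
    unfolding product_sigma_finite_def using sfP by blast
  interpret sfP: sigma_finite_measure ?L by fact
  interpret sf1: sigma_finite_measure "\<Pi>\<^sub>M l\<in>{k} \<times> P. (lborel :: real measure)"
    using assms(2) by (intro product_sigma_finite.sigma_finite product_sigma_finite_lborel) auto
  let ?c = "\<lambda>K (w::'k \<times> 'p \<Rightarrow> real). \<lambda>k\<in>K. \<lambda>p\<in>P. w (k, p)"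
  note [measurable] = insert.prems
  have mc [measurable]: "?c K' \<in> (\<Pi>\<^sub>M l\<in>K' \<times> P. lborel) \<rightarrow>\<^sub>M (\<Pi>\<^sub>M k\<in>K'. ?L)" for K'
    by (intro measurable_restrict measurable_component_singleton) auto
  have split': "insert k K \<times> P = (K \<times> P) \<union> ({k} \<times> P)" by auto
  have hc: "(\<lambda>w. h (?c (insert k K) w)) \<in> borel_measurable (\<Pi>\<^sub>M l\<in>(K \<times> P) \<union> ({k} \<times> P). lborel)"
    using measurable_compose[OF mc insert.prems] unfolding split' .
  have upd [measurable]: "(\<lambda>(Y, y). Y(k := y)) \<in> (\<Pi>\<^sub>M k\<in>K. ?L) \<Otimes>\<^sub>M ?L \<rightarrow>\<^sub>M (\<Pi>\<^sub>M k\<in>insert k K. ?L)"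
    using measurable_add_dim[of k K "\<lambda>_. ?L"] by simp
  have hupd [measurable]: "(\<lambda>(Y, y). h (Y(k := y))) \<in> borel_measurable ((\<Pi>\<^sub>M k\<in>K. ?L) \<Otimes>\<^sub>M ?L)"
    using measurable_compose[OF upd insert.prems] by (simp add: case_prod_beta')
  have "(\<integral>\<^sup>+w. h (?c (insert k K) w) \<partial>(\<Pi>\<^sub>M l\<in>insert k K \<times> P. lborel)) =
      (\<integral>\<^sup>+w. (\<integral>\<^sup>+v. h (?c (insert k K) (merge (K \<times> P) ({k} \<times> P) (w, v)))
         \<partial>(\<Pi>\<^sub>M l\<in>{k} \<times> P. lborel)) \<partial>(\<Pi>\<^sub>M l\<in>K \<times> P. lborel))"
    unfolding split' using insert.hyps assms(2) hc
    by (intro L.product_nn_integral_fold) auto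
  also have "\<dots> = (\<integral>\<^sup>+w. (\<integral>\<^sup>+v. h ((?c K w)(k := \<lambda>p\<in>P. v (k, p)))
         \<partial>(\<Pi>\<^sub>M l\<in>{k} \<times> P. lborel)) \<partial>(\<Pi>\<^sub>M l\<in>K \<times> P. lborel))"
  proof (intro nn_integral_cong arg_cong[of _ _ h])
    fix w v
    show "?c (insert k K) (merge (K \<times> P) ({k} \<times> P) (w, v)) = (?c K w)(k := \<lambda>p\<in>P. v (k, p))"
      using insert.hyps by (auto simp: fun_eq_iff merge_def restrict_def)
  qed
  also have "\<dots> = (\<integral>\<^sup>+w. (\<integral>\<^sup>+y. h ((?c K w)(k := y)) \<partial>?L) \<partial>(\<Pi>\<^sub>M l\<in>K \<times> P. lborel))"
  proof (intro nn_integral_cong)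
    fix w :: "'k \<times> 'p \<Rightarrow> real" assume "w \<in> space (\<Pi>\<^sub>M l\<in>K \<times> P. lborel)"
    then have "?c K w \<in> space (\<Pi>\<^sub>M k\<in>K. ?L)" using measurable_space[OF mc] by blast
    then have "(\<lambda>y. h ((?c K w)(k := y))) \<in> borel_measurable ?L"
      using measurable_compose[OF measurable_Pair1' hupd] by simp
    moreover have "bij_betw (Pair k) P ({k} \<times> P)" by (auto simp: bij_betw_def inj_on_def)
    ultimately show "(\<integral>\<^sup>+v. h ((?c K w)(k := \<lambda>p\<in>P. v (k, p))) \<partial>(\<Pi>\<^sub>M l\<in>{k} \<times> P. lborel)) =
        (\<integral>\<^sup>+y. h ((?c K w)(k := y)) \<partial>?L)"
      using assms(2) by (intro nn_integral_PiM_reindex) auto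
  qed
  also have "\<dots> = (\<integral>\<^sup>+Y. (\<integral>\<^sup>+y. h (Y(k := y)) \<partial>?L) \<partial>(\<Pi>\<^sub>M k\<in>K. ?L))"
    using sigma_finite_measure.borel_measurable_nn_integral[OF sfP hupd] by (intro insert.IH)
  also have "\<dots> = (\<integral>\<^sup>+Y. h Y \<partial>(\<Pi>\<^sub>M k\<in>insert k K. ?L))"
    using insert.hyps insert.prems by (intro O.product_nn_integral_insert[symmetric])
  finally show ?case .
qed

lemma nn_integral_obs_profile:
  assumes h [measurable]: "h \<in> borel_measurable (\<Pi>\<^sub>M k\<in>{1..n}. obs_space n)"
  shows "(\<integral>\<^sup>+x. (\<integral>\<^sup>+z. h (\<lambda>k\<in>{1..n}. \<lambda>p\<in>{1..n}. if p = 1 then x k else z (source k p, k))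
            \<partial>(\<Pi>\<^sub>M l\<in>links n. lborel)) \<partial>(\<Pi>\<^sub>M i\<in>{1..n}. lborel)) =
         (\<integral>\<^sup>+Y. h Y \<partial>(\<Pi>\<^sub>M k\<in>{1..n}. obs_space n))"
proof -
  interpret L: product_sigma_finite "\<lambda>_::nat \<times> nat. (lborel :: real measure)"
    by (rule product_sigma_finite_lborel)
  interpret sfD: sigma_finite_measure "\<Pi>\<^sub>M l\<in>links n. (lborel :: real measure)"
    by (intro L.sigma_finite finite_links)
  let ?N = "{1..n}"
  let ?D = "(\<lambda>k. (k, k)) ` ?N"
  let ?c = "\<lambda>w :: nat \<times> nat \<Rightarrow> real. \<lambda>k\<in>?N. \<lambda>p\<in>?N. w (k, p)"
  let ?r = "\<lambda>w :: nat \<times> nat \<Rightarrow> real. \<lambda>k\<in>?N. \<lambda>p\<in>?N. w (source k p, k)"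
  have src: "(source k p, k) \<in> ?N \<times> ?N" if "k \<in> ?N" "p \<in> ?N" for k p
    using that by (auto simp: source_def)
  have src': "(source k p, k) \<in> links n \<and> (source k p, k) \<notin> ?D"
    if "k \<in> ?N" "p \<in> ?N" "p \<noteq> 1" for k p
    using that by (auto simp: source_def links_def)
  have un: "?N \<times> ?N = ?D \<union> links n" by (auto simp: links_def)
  have mc: "?c \<in> (\<Pi>\<^sub>M l\<in>?N \<times> ?N. lborel) \<rightarrow>\<^sub>M (\<Pi>\<^sub>M k\<in>?N. obs_space n)"
    unfolding obs_space_def by (intro measurable_restrict measurable_component_singleton) auto
  have mr: "?r \<in> (\<Pi>\<^sub>M l\<in>?N \<times> ?N. lborel) \<rightarrow>\<^sub>M (\<Pi>\<^sub>M k\<in>?N. obs_space n)"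
    unfolding obs_space_def using src by (intro measurable_restrict measurable_component_singleton) auto
  have mT: "(\<lambda>(x, z). \<lambda>k\<in>?N. \<lambda>p\<in>?N. if p = 1 then x k else z (source k p, k))
      \<in> (\<Pi>\<^sub>M i\<in>?N. lborel) \<Otimes>\<^sub>M (\<Pi>\<^sub>M l\<in>links n. lborel) \<rightarrow>\<^sub>M (\<Pi>\<^sub>M k\<in>?N. obs_space n)"
    unfolding obs_space_def case_prod_beta'
  proof (intro measurable_restrict)
    fix k p assume kp: "k \<in> ?N" "p \<in> ?N"
    show "(\<lambda>w. if p = 1 then fst w k else snd w (source k p, k))
      \<in> (\<Pi>\<^sub>M i\<in>?N. lborel) \<Otimes>\<^sub>M (\<Pi>\<^sub>M l\<in>links n. lborel) \<rightarrow>\<^sub>M (lborel :: real measure)"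
    proof (cases "p = 1")
      case True
      then show ?thesis using kp by simp
    next
      case False
      then have "(source k p, k) \<in> links n" using src' kp by blast
      then show ?thesis using False by simp
    qed
  qed
  have mhT: "(\<lambda>(x, z). h (\<lambda>k\<in>?N. \<lambda>p\<in>?N. if p = 1 then x k else z (source k p, k)))
      \<in> borel_measurable ((\<Pi>\<^sub>M i\<in>?N. lborel) \<Otimes>\<^sub>M (\<Pi>\<^sub>M l\<in>links n. lborel))"
    using measurable_compose[OF mT h] by (simp only: case_prod_beta')
  have "(\<integral>\<^sup>+Y. h Y \<partial>(\<Pi>\<^sub>M k\<in>?N. obs_space n)) = (\<integral>\<^sup>+w. h (?c w) \<partial>(\<Pi>\<^sub>M l\<in>?N \<times> ?N. lborel))"
    using nn_integral_PiM_curry[of ?N ?N h] h by (simp add: obs_space_def)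
  also have "\<dots> = (\<integral>\<^sup>+w. h (?c (\<lambda>l\<in>?N \<times> ?N. w (case l of (k, p) \<Rightarrow> (source k p, k))))
      \<partial>(\<Pi>\<^sub>M l\<in>?N \<times> ?N. lborel))"
    using measurable_compose[OF mc h] bij_betw_source_full[of n]
    by (intro nn_integral_PiM_reindex[symmetric]) auto
  also have "\<dots> = (\<integral>\<^sup>+w. h (?r w) \<partial>(\<Pi>\<^sub>M l\<in>?N \<times> ?N. lborel))"
    by (intro nn_integral_cong arg_cong[of _ _ h]) (auto simp: fun_eq_iff)
  also have "\<dots> = (\<integral>\<^sup>+v. (\<integral>\<^sup>+z. h (?r (merge ?D (links n) (v, z)))
      \<partial>(\<Pi>\<^sub>M l\<in>links n. lborel)) \<partial>(\<Pi>\<^sub>M l\<in>?D. lborel))"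
    using measurable_compose[OF mr h] finite_links[of n] unfolding un
    by (intro L.product_nn_integral_fold) (auto simp: links_def)
  also have "\<dots> = (\<integral>\<^sup>+v. (\<integral>\<^sup>+z. h (\<lambda>k\<in>?N. \<lambda>p\<in>?N.
      if p = 1 then (\<lambda>k\<in>?N. v (k, k)) k else z (source k p, k))
      \<partial>(\<Pi>\<^sub>M l\<in>links n. lborel)) \<partial>(\<Pi>\<^sub>M l\<in>?D. lborel))"
  proof (intro nn_integral_cong arg_cong[of _ _ h])
    fix v z :: "nat \<times> nat \<Rightarrow> real"
    have "merge ?D (links n) (v, z) (source k p, k) =
        (if p = 1 then (\<lambda>k\<in>?N. v (k, k)) k else z (source k p, k))"
      if kp: "k \<in> ?N" "p \<in> ?N" for k p
    proof (cases "p = 1")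
      case True
      then show ?thesis using kp by (simp add: merge_def source_def)
    next
      case False
      then show ?thesis using src'[OF kp False] by (simp add: merge_def)
    qed
    then show "?r (merge ?D (links n) (v, z)) =
        (\<lambda>k\<in>?N. \<lambda>p\<in>?N. if p = 1 then (\<lambda>k\<in>?N. v (k, k)) k else z (source k p, k))"
      by (intro restrict_ext) simp
  qed
  also have "\<dots> = (\<integral>\<^sup>+x. (\<integral>\<^sup>+z. h (\<lambda>k\<in>?N. \<lambda>p\<in>?N. if p = 1 then x k else z (source k p, k))
            \<partial>(\<Pi>\<^sub>M l\<in>links n. lborel)) \<partial>(\<Pi>\<^sub>M i\<in>?N. lborel))"
    using sfD.borel_measurable_nn_integral[OF mhT]
    by (intro nn_integral_PiM_reindex[where b = "\<lambda>k. (k, k)"]) (auto simp: bij_betw_def inj_on_def)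
  finally show ?thesis ..
qed

lemma borel_measurable_normal_density2:
  assumes [measurable]: "f \<in> borel_measurable M" "g \<in> borel_measurable M"
  shows "(\<lambda>w. normal_density (f w) s (g w)) \<in> borel_measurable M"
  unfolding normal_density_def by measurable

lemma distributed_joint_density:
  assumes "\<sigma> > 0" "\<tau> > 0"
  shows "distributed (game_measure n \<sigma> \<tau>) (lborel \<Otimes>\<^sub>M (\<Pi>\<^sub>M i\<in>{1..n}. obs_space n))
           (\<lambda>\<omega>. (fundamental \<omega>, \<lambda>i\<in>{1..n}. observation n i \<omega>))
           (\<lambda>(\<theta>, Y). ennreal (joint_density n \<sigma> \<tau> \<theta> Y))"
proof -
  let ?N = "{1..n}"
  let ?A = "\<Pi>\<^sub>M i\<in>?N. density lborel (normal_density 0 \<sigma>)"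
  let ?B = "\<Pi>\<^sub>M l\<in>links n. density lborel (normal_density 0 \<tau>)"
  let ?X = "\<Pi>\<^sub>M i\<in>?N. (lborel :: real measure)"
  let ?Z = "\<Pi>\<^sub>M l\<in>links n. (lborel :: real measure)"
  let ?O = "\<Pi>\<^sub>M i\<in>?N. obs_space n"
  let ?obs = "\<lambda>\<omega>. (fundamental \<omega>, \<lambda>i\<in>?N. observation n i \<omega>)"
  let ?T = "\<lambda>x z. \<lambda>k\<in>?N. \<lambda>p\<in>?N. if p = 1 then x k else z (source k p, k) :: real"
  let ?\<phi> = "\<lambda>\<theta> x. ennreal (\<Prod>k\<in>?N. normal_density \<theta> \<sigma> (x k))"
  let ?\<psi> = "\<lambda>x z. ennreal (\<Prod>l\<in>links n. normal_density (x (fst l)) \<tau> (z l))"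
  let ?M = "lborel \<Otimes>\<^sub>M ?X \<Otimes>\<^sub>M ?Z :: state measure"

  have src: "(source k p, k) \<in> links n" if "k \<in> ?N" "p \<in> ?N" "p \<noteq> 1" for k p
    using that by (auto simp: source_def links_def)
  have src1: "source k p \<in> ?N" if "k \<in> ?N" "p \<in> ?N" for k p
    using that by (auto simp: source_def)

  interpret LX: product_sigma_finite "\<lambda>_::nat. (lborel :: real measure)"
    by (rule product_sigma_finite_lborel)
  interpret LZ: product_sigma_finite "\<lambda>_::nat \<times> nat. (lborel :: real measure)"
    by (rule product_sigma_finite_lborel)
  interpret X: sigma_finite_measure ?X by (intro LX.sigma_finite) simp
  interpret Z: sigma_finite_measure ?Z by (intro LZ.sigma_finite finite_links)
  interpret A: sigma_finite_measure ?A
    using assms by (intro product_sigma_finite.sigma_finite product_sigma_finite_normal) auto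
  interpret B: sigma_finite_measure ?B
    using assms by (intro product_sigma_finite.sigma_finite product_sigma_finite_normal finite_links) auto
  interpret AB: pair_sigma_finite ?A ?B ..
  interpret Ob: sigma_finite_measure "obs_space n"
    unfolding obs_space_def by (intro LX.sigma_finite) simp
  interpret LO: product_sigma_finite "\<lambda>_::nat. obs_space n" ..
  interpret O: sigma_finite_measure ?O by (intro LO.sigma_finite) simp

  have sA [measurable_cong]: "sets ?A = sets ?X" by (intro sets_PiM_cong) auto
  have sB [measurable_cong]: "sets ?B = sets ?Z" by (intro sets_PiM_cong) auto
  have sM: "sets (game_measure n \<sigma> \<tau>) = sets ?M"
    unfolding game_measure_def by (intro sets_pair_measure_cong refl sA sB)
  have mobs: "?obs \<in> ?M \<rightarrow>\<^sub>M lborel \<Otimes>\<^sub>M ?O"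
  proof (intro measurable_Pair)
    show "fundamental \<in> ?M \<rightarrow>\<^sub>M lborel"
      by (rule measurable_cong[THEN iffD2, where g1 = fst]) (auto simp: space_pair_measure)
    have "(\<lambda>\<omega>. if p = 1 then private_signal i \<omega> else shared_signal (source i p) i \<omega>) \<in> ?M \<rightarrow>\<^sub>M lborel"
      if ip: "i \<in> ?N" "p \<in> ?N" for i p
    proof (cases "p = 1")
      case True
      have "(\<lambda>\<omega>. fst \<omega> + fst (snd \<omega>) i) \<in> ?M \<rightarrow>\<^sub>M lborel"
        using ip by simp
      moreover have "private_signal i = (\<lambda>\<omega>. fst \<omega> + fst (snd \<omega>) i)" by auto
      ultimately show ?thesis using True by simp
    next
      case False
      have "(\<lambda>\<omega>. fst \<omega> + fst (snd \<omega>) (source i p) + snd (snd \<omega>) (source i p, i)) \<in> ?M \<rightarrow>\<^sub>M lborel"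
        using src1[OF ip] src[OF ip False] by simp
      moreover have "shared_signal (source i p) i =
          (\<lambda>\<omega>. fst \<omega> + fst (snd \<omega>) (source i p) + snd (snd \<omega>) (source i p, i))" by auto
      ultimately show ?thesis using False by simp
    qed
    then show "(\<lambda>\<omega>. \<lambda>i\<in>?N. observation n i \<omega>) \<in> ?M \<rightarrow>\<^sub>M ?O"
      unfolding observation_def obs_space_def by (intro measurable_restrict)
  qed
  then have mobs': "?obs \<in> game_measure n \<sigma> \<tau> \<rightarrow>\<^sub>M lborel \<Otimes>\<^sub>M ?O"
    by (simp add: measurable_cong_sets[OF sM refl])

  have comp: "(\<lambda>w. snd w k p) \<in> borel_measurable ((lborel :: real measure) \<Otimes>\<^sub>M ?O)" if "k \<in> ?N" "p \<in> ?N" for k p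
  proof -
    have 1: "(\<lambda>y. y p) \<in> obs_space n \<rightarrow>\<^sub>M lborel"
      unfolding obs_space_def using that by (intro measurable_component_singleton)
    have 2: "(\<lambda>w. snd w k) \<in> (lborel :: real measure) \<Otimes>\<^sub>M ?O \<rightarrow>\<^sub>M obs_space n"
      using that by (intro measurable_compose[OF measurable_snd measurable_component_singleton])
    show ?thesis using measurable_compose[OF 2 1] by simp
  qed
  have mf: "(\<lambda>(\<theta>, Y). ennreal (joint_density n \<sigma> \<tau> \<theta> Y)) \<in> borel_measurable (lborel \<Otimes>\<^sub>M ?O)"
    unfolding joint_density_def case_prod_beta'
    by (intro measurable_compose[OF _ measurable_ennreal] borel_measurable_times
        borel_measurable_prod borel_measurable_normal_density2 comp) (auto simp: source_def)

  have dens: "ennreal (joint_density n \<sigma> \<tau> \<theta> (?T x z)) = ?\<phi> \<theta> x * ?\<psi> x z" for \<theta> x z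
  proof -
    have "(\<Prod>k\<in>?N. \<Prod>p\<in>{2..n}. normal_density (?T x z (source k p) 1) \<tau> (?T x z k p)) =
        (\<Prod>(k, p)\<in>?N \<times> {2..n}. normal_density (x (source k p)) \<tau> (z (source k p, k)))"
      unfolding prod.cartesian_product
      by (intro prod.cong refl) (auto simp: source_def)
    also have "\<dots> = (\<Prod>l\<in>links n. normal_density (x (fst l)) \<tau> (z l))"
      by (subst prod.reindex_bij_betw[OF bij_betw_source, symmetric]) (auto intro!: prod.cong)
    finally have "joint_density n \<sigma> \<tau> \<theta> (?T x z) =
        (\<Prod>k\<in>?N. normal_density \<theta> \<sigma> (x k)) * (\<Prod>l\<in>links n. normal_density (x (fst l)) \<tau> (z l))"
      unfolding joint_density_def by (auto intro!: prod.cong)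
    then show ?thesis by (simp add: ennreal_mult prod_nonneg)
  qed

  have main: "(\<integral>\<^sup>+\<omega>. g (?obs \<omega>) \<partial>game_measure n \<sigma> \<tau>) =
      (\<integral>\<^sup>+w. (case w of (\<theta>, Y) \<Rightarrow> ennreal (joint_density n \<sigma> \<tau> \<theta> Y)) * g w \<partial>(lborel \<Otimes>\<^sub>M ?O))"
    if g: "g \<in> borel_measurable (lborel \<Otimes>\<^sub>M ?O)" for g
  proof -
    have mT: "(\<lambda>(\<theta>, x, z). (\<theta>, ?T x z)) \<in> ?M \<rightarrow>\<^sub>M lborel \<Otimes>\<^sub>M ?O"
      unfolding case_prod_beta'
    proof (intro measurable_Pair)
      have "(\<lambda>\<omega>. if p = 1 then fst (snd \<omega>) i else snd (snd \<omega>) (source i p, i)) \<in> ?M \<rightarrow>\<^sub>M lborel"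
        if ip: "i \<in> ?N" "p \<in> ?N" for i p
        by (cases "p = 1") (use ip src in auto)
      then show "(\<lambda>\<omega>. ?T (fst (snd \<omega>)) (snd (snd \<omega>))) \<in> ?M \<rightarrow>\<^sub>M ?O"
        unfolding obs_space_def by (intro measurable_restrict)
    qed simp
    have gT [measurable]: "(\<lambda>(\<theta>, x, z). g (\<theta>, ?T x z)) \<in> borel_measurable ?M"
      using measurable_compose[OF mT g] by (simp add: case_prod_beta')
    have gobs: "(\<lambda>\<omega>. g (?obs \<omega>)) \<in> borel_measurable (lborel \<Otimes>\<^sub>M ?A \<Otimes>\<^sub>M ?B)"
      using measurable_compose[OF mobs' g] by (simp add: game_measure_def)
    have m\<psi> [measurable]: "(\<lambda>(x, z). ?\<psi> x z) \<in> borel_measurable (?X \<Otimes>\<^sub>M ?Z)"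
      unfolding case_prod_beta'
      by (intro measurable_compose[OF _ measurable_ennreal] borel_measurable_prod borel_measurable_normal_density2) (auto simp: links_def)
    have "(\<integral>\<^sup>+\<omega>. g (?obs \<omega>) \<partial>game_measure n \<sigma> \<tau>) =
        (\<integral>\<^sup>+\<theta>. (\<integral>\<^sup>+\<xi>. (\<integral>\<^sup>+\<zeta>. g (?obs (\<theta>, \<xi>, \<zeta>)) \<partial>?B) \<partial>?A) \<partial>lborel)"
    proof -
      have "sigma_finite_measure (?A \<Otimes>\<^sub>M ?B)" by unfold_locales
      then have "(\<integral>\<^sup>+\<omega>. g (?obs \<omega>) \<partial>game_measure n \<sigma> \<tau>) =
          (\<integral>\<^sup>+\<theta>. (\<integral>\<^sup>+w. g (?obs (\<theta>, w)) \<partial>(?A \<Otimes>\<^sub>M ?B)) \<partial>lborel)"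
        unfolding game_measure_def
        by (rule sigma_finite_measure.nn_integral_fst[OF _ gobs, symmetric])
      also have "\<dots> = (\<integral>\<^sup>+\<theta>. (\<integral>\<^sup>+\<xi>. (\<integral>\<^sup>+\<zeta>. g (?obs (\<theta>, \<xi>, \<zeta>)) \<partial>?B) \<partial>?A) \<partial>lborel)"
      proof (intro nn_integral_cong)
        fix \<theta> :: real
        have "(\<lambda>w. g (?obs (\<theta>, w))) \<in> borel_measurable (?A \<Otimes>\<^sub>M ?B)"
          using measurable_compose[OF measurable_Pair1' gobs] by simp
        from B.nn_integral_fst[OF this]
        show "(\<integral>\<^sup>+w. g (?obs (\<theta>, w)) \<partial>(?A \<Otimes>\<^sub>M ?B)) = (\<integral>\<^sup>+\<xi>. (\<integral>\<^sup>+\<zeta>. g (?obs (\<theta>, \<xi>, \<zeta>)) \<partial>?B) \<partial>?A)"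
          by simp
      qed
      finally show ?thesis .
    qed
    also have "\<dots> = (\<integral>\<^sup>+\<theta>. (\<integral>\<^sup>+\<xi>. (\<integral>\<^sup>+z. ?\<psi> (\<lambda>i\<in>?N. \<theta> + \<xi> i) z * g (\<theta>, ?T (\<lambda>i\<in>?N. \<theta> + \<xi> i) z) \<partial>?Z) \<partial>?A) \<partial>lborel)"
    proof (intro nn_integral_cong)
      fix \<theta> \<xi>
      assume "\<xi> \<in> space ?A"
      define x where "x = (\<lambda>i\<in>?N. \<theta> + \<xi> i)"
      have x: "x \<in> space ?X" by (auto simp: x_def space_PiM)
      have obs: "?obs (\<theta>, \<xi>, \<zeta>) = (\<theta>, ?T x (\<lambda>l\<in>links n. x (fst l) + \<zeta> l))" for \<zeta>
        using src src1 by (auto simp: observation_def x_def intro!: restrict_ext)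
      have "(\<lambda>z. (\<theta>, x, z)) \<in> ?Z \<rightarrow>\<^sub>M ?M" using x by simp
      from measurable_compose[OF this gT] have "(\<lambda>z. g (\<theta>, ?T x z)) \<in> borel_measurable ?Z" by simp
      from nn_integral_shifted_normals[OF finite_links assms(2) this, of "\<lambda>l. x (fst l)"]
      show "(\<integral>\<^sup>+\<zeta>. g (?obs (\<theta>, \<xi>, \<zeta>)) \<partial>?B) =
          (\<integral>\<^sup>+z. ?\<psi> (\<lambda>i\<in>?N. \<theta> + \<xi> i) z * g (\<theta>, ?T (\<lambda>i\<in>?N. \<theta> + \<xi> i) z) \<partial>?Z)"
        unfolding obs by (simp only: x_def)
    qed
    also have "\<dots> = (\<integral>\<^sup>+\<theta>. (\<integral>\<^sup>+x. ?\<phi> \<theta> x * (\<integral>\<^sup>+z. ?\<psi> x z * g (\<theta>, ?T x z) \<partial>?Z) \<partial>?X) \<partial>lborel)"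
    proof (intro nn_integral_cong)
      fix \<theta> :: real
      have "(\<lambda>(x, z). ?\<psi> x z * g (\<theta>, ?T x z)) \<in> borel_measurable (?X \<Otimes>\<^sub>M ?Z)"
        unfolding case_prod_beta'
      proof (rule borel_measurable_times_ennreal)
        show "(\<lambda>w. ?\<psi> (fst w) (snd w)) \<in> borel_measurable (?X \<Otimes>\<^sub>M ?Z)"
          using m\<psi> by (simp only: case_prod_beta')
        have "Pair \<theta> \<in> ?X \<Otimes>\<^sub>M ?Z \<rightarrow>\<^sub>M ?M" by simp
        from measurable_compose[OF this gT]
        show "(\<lambda>w. g (\<theta>, ?T (fst w) (snd w))) \<in> borel_measurable (?X \<Otimes>\<^sub>M ?Z)"
          unfolding case_prod_beta' fst_conv snd_conv .
      qed
      from nn_integral_shifted_normals[OF _ assms(1) Z.borel_measurable_nn_integral[OF this], of "\<lambda>_. \<theta>"]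
      show "(\<integral>\<^sup>+\<xi>. (\<integral>\<^sup>+z. ?\<psi> (\<lambda>i\<in>?N. \<theta> + \<xi> i) z * g (\<theta>, ?T (\<lambda>i\<in>?N. \<theta> + \<xi> i) z) \<partial>?Z) \<partial>?A) =
          (\<integral>\<^sup>+x. ?\<phi> \<theta> x * (\<integral>\<^sup>+z. ?\<psi> x z * g (\<theta>, ?T x z) \<partial>?Z) \<partial>?X)"
        by simp
    qed
    also have "\<dots> = (\<integral>\<^sup>+\<theta>. (\<integral>\<^sup>+Y. ennreal (joint_density n \<sigma> \<tau> \<theta> Y) * g (\<theta>, Y) \<partial>?O) \<partial>lborel)"
    proof (intro nn_integral_cong)
      fix \<theta> :: real
      have m: "(\<lambda>Y. ennreal (joint_density n \<sigma> \<tau> \<theta> Y) * g (\<theta>, Y)) \<in> borel_measurable ?O"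
        using measurable_compose[OF measurable_Pair1' mf, of \<theta>]
          measurable_compose[OF measurable_Pair1' g, of \<theta>] by simp
      have "(\<integral>\<^sup>+x. ?\<phi> \<theta> x * (\<integral>\<^sup>+z. ?\<psi> x z * g (\<theta>, ?T x z) \<partial>?Z) \<partial>?X) =
          (\<integral>\<^sup>+x. (\<integral>\<^sup>+z. ennreal (joint_density n \<sigma> \<tau> \<theta> (?T x z)) * g (\<theta>, ?T x z) \<partial>?Z) \<partial>?X)"
      proof (intro nn_integral_cong)
        fix x assume x: "x \<in> space ?X"
        have "(\<lambda>z. (\<theta>, x, z)) \<in> ?Z \<rightarrow>\<^sub>M ?M" using x by simp
        from measurable_compose[OF this gT] have "(\<lambda>z. g (\<theta>, ?T x z)) \<in> borel_measurable ?Z" by simp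
        moreover have "(\<lambda>z. ?\<psi> x z) \<in> borel_measurable ?Z"
          using measurable_compose[OF measurable_Pair1'[OF x] m\<psi>] by simp
        ultimately show "?\<phi> \<theta> x * (\<integral>\<^sup>+z. ?\<psi> x z * g (\<theta>, ?T x z) \<partial>?Z) =
            (\<integral>\<^sup>+z. ennreal (joint_density n \<sigma> \<tau> \<theta> (?T x z)) * g (\<theta>, ?T x z) \<partial>?Z)"
          unfolding dens mult.assoc by (intro nn_integral_cmult[symmetric] borel_measurable_times_ennreal)
      qed
      also have "\<dots> = (\<integral>\<^sup>+Y. ennreal (joint_density n \<sigma> \<tau> \<theta> Y) * g (\<theta>, Y) \<partial>?O)"
        by (rule nn_integral_obs_profile[OF m])
      finally show "(\<integral>\<^sup>+x. ?\<phi> \<theta> x * (\<integral>\<^sup>+z. ?\<psi> x z * g (\<theta>, ?T x z) \<partial>?Z) \<partial>?X) = \<dots>" .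
    qed
    also have "\<dots> = (\<integral>\<^sup>+w. (case w of (\<theta>, Y) \<Rightarrow> ennreal (joint_density n \<sigma> \<tau> \<theta> Y)) * g w \<partial>(lborel \<Otimes>\<^sub>M ?O))"
      using O.nn_integral_fst[OF borel_measurable_times_ennreal[OF mf g]] by simp
    finally show ?thesis .
  qed

  have "distr (game_measure n \<sigma> \<tau>) (lborel \<Otimes>\<^sub>M ?O) ?obs =
      density (lborel \<Otimes>\<^sub>M ?O) (\<lambda>(\<theta>, Y). ennreal (joint_density n \<sigma> \<tau> \<theta> Y))"
  proof (rule measure_eqI)
    fix S assume "S \<in> sets (distr (game_measure n \<sigma> \<tau>) (lborel \<Otimes>\<^sub>M ?O) ?obs)"
    then have S: "S \<in> sets (lborel \<Otimes>\<^sub>M ?O)" by simp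
    have "emeasure (distr (game_measure n \<sigma> \<tau>) (lborel \<Otimes>\<^sub>M ?O) ?obs) S =
        (\<integral>\<^sup>+w. indicator S w \<partial>distr (game_measure n \<sigma> \<tau>) (lborel \<Otimes>\<^sub>M ?O) ?obs)"
      using S by simp
    also have "\<dots> = (\<integral>\<^sup>+\<omega>. indicator S (?obs \<omega>) \<partial>game_measure n \<sigma> \<tau>)"
      using S by (intro nn_integral_distr[OF mobs']) simp
    also have "\<dots> = emeasure (density (lborel \<Otimes>\<^sub>M ?O)
        (\<lambda>(\<theta>, Y). ennreal (joint_density n \<sigma> \<tau> \<theta> Y))) S"
      unfolding emeasure_density[OF mf S] using S by (intro main) simp
    finally show "emeasure (distr (game_measure n \<sigma> \<tau>) (lborel \<Otimes>\<^sub>M ?O) ?obs) S = \<dots>" .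
  qed simp
  then show ?thesis
    unfolding distributed_def using mf mobs' by blast
qed

end

theory Submission
  imports Defs
begin

text \<open>
  Observing \<open>u + v\<close> instead of \<open>u\<close> translates the posterior of agent \<open>i\<close> by the conditional means
  given \<open>v\<close>.  Lowering the own signal while raising the reports of all others can keep the posterior
  mean of \<open>\<theta>\<close> fixed and yet raise the posterior mean of every other agent \<open>j\<close>, because \<open>j\<close> trusts the
  signal of \<open>i\<close> less than the own one.  So on the hyperplane where agent \<open>i\<close> is at the threshold
  \<open>t\<^sub>i\<close>, the expected number of other risky agents gets arbitrarily close to \<open>0\<close>, whence
  \<open>t\<^sub>i \<le> 1\<close>; on the safe hyperplane at \<open>t\<^sub>i + 1/2\<close> it gets arbitrarily close to \<open>n - 1\<close>, whence
  \<open>n \<le> t\<^sub>i + 1/2\<close>.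
\<close>

section \<open>Translation invariance of the reference measures\<close>

text \<open>A \<sigma>-finite product measure is determined by its values on boxes, and the preimage
  of a box under a componentwise map is the box of the preimages.\<close>

lemma distr_PiM_componentwise_invariant:
  assumes "product_sigma_finite M" and fin: "finite I"
    and meas: "\<And>i. i \<in> I \<Longrightarrow> \<phi> i \<in> M i \<rightarrow>\<^sub>M M i"
    and inv: "\<And>i. i \<in> I \<Longrightarrow> distr (M i) (M i) (\<phi> i) = M i"
  shows "distr (PiM I M) (PiM I M) (\<lambda>x. \<lambda>i\<in>I. \<phi> i (x i)) = PiM I M"
proof -
  interpret product_sigma_finite M by fact
  have mT: "(\<lambda>x. \<lambda>i\<in>I. \<phi> i (x i)) \<in> PiM I M \<rightarrow>\<^sub>M PiM I M"
    by (intro measurable_restrict measurable_compose[OF _ meas] measurable_component_singleton)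
  show ?thesis
  proof (rule PiM_eqI)
    fix A assume A: "\<And>i. i \<in> I \<Longrightarrow> A i \<in> sets (M i)"
    have eq: "(\<lambda>x. \<lambda>i\<in>I. \<phi> i (x i)) -` Pi\<^sub>E I A \<inter> space (PiM I M)
        = Pi\<^sub>E I (\<lambda>i. \<phi> i -` A i \<inter> space (M i))"
      by (auto simp: space_PiM PiE_iff)
    have "emeasure (distr (PiM I M) (PiM I M) (\<lambda>x. \<lambda>i\<in>I. \<phi> i (x i))) (Pi\<^sub>E I A)
        = emeasure (PiM I M) (Pi\<^sub>E I (\<lambda>i. \<phi> i -` A i \<inter> space (M i)))"
      unfolding eq[symmetric] using A fin by (intro emeasure_distr[OF mT] sets_PiM_I_finite)
    also have "\<dots> = (\<Prod>i\<in>I. emeasure (M i) (\<phi> i -` A i \<inter> space (M i)))"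
      using fin A meas by (intro emeasure_PiM measurable_sets) auto
    also have "\<dots> = (\<Prod>i\<in>I. emeasure (M i) (A i))"
      using A by (intro prod.cong refl) (metis emeasure_distr inv meas)
    finally show "emeasure (distr (PiM I M) (PiM I M) (\<lambda>x. \<lambda>i\<in>I. \<phi> i (x i))) (Pi\<^sub>E I A)
        = (\<Prod>i\<in>I. emeasure (M i) (A i))" .
  qed (use fin in simp_all)
qed

lemma sigma_finite_obs_space: "sigma_finite_measure (obs_space n)"
  unfolding obs_space_def
  by (intro product_sigma_finite.sigma_finite product_sigma_finite_lborel) simp

lemma product_sigma_finite_obs_space: "product_sigma_finite (\<lambda>_. obs_space n)"
  unfolding product_sigma_finite_def using sigma_finite_obs_space by blast

lemma measurable_obs_space_component:
  assumes "p \<in> {1..n}" "f \<in> M \<rightarrow>\<^sub>M obs_space n"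
  shows "(\<lambda>w. f w p) \<in> borel_measurable M"
proof -
  have "(\<lambda>y. y p) \<in> obs_space n \<rightarrow>\<^sub>M lborel"
    unfolding obs_space_def using assms(1) by (intro measurable_component_singleton)
  from measurable_compose[OF assms(2) this] show ?thesis by simp
qed

text \<open>The restriction makes the result a point of \<open>obs_space n\<close> even for a
  \<open>y\<close> that is not extensional, such as the constant 0 from which the final argument
  starts.\<close>

definition translate :: "nat \<Rightarrow> (nat \<Rightarrow> real) \<Rightarrow> (nat \<Rightarrow> real) \<Rightarrow> (nat \<Rightarrow> real)" where
  "translate n v y = (\<lambda>p\<in>{1..n}. y p + v p)"

lemma measurable_translate [measurable]: "translate n v \<in> obs_space n \<rightarrow>\<^sub>M obs_space n"
  unfolding translate_def obs_space_def by measurable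

lemma translate_in_space: "translate n v y \<in> space (obs_space n)"
  by (simp add: translate_def obs_space_def space_PiM)

lemma distr_lborel_add: "distr lborel lborel (\<lambda>x. x + c) = lborel" for c :: real
proof -
  have "distr lborel lborel (\<lambda>x. x + c) = distr lborel borel ((+) c)"
    by (intro distr_cong) (auto simp: add.commute)
  then show ?thesis by (simp add: lborel_distr_plus)
qed

lemma distr_translate: "distr (obs_space n) (obs_space n) (translate n v) = obs_space n"
  unfolding obs_space_def translate_def
  by (intro distr_PiM_componentwise_invariant product_sigma_finite_lborel distr_lborel_add) auto

text \<open>The reference measure \<open>B\<close> inside \<open>posterior\<close>, that is,
  Lebesgue measure on everything agent \<open>i\<close> does not see.\<close>

definition unobserved :: "nat \<Rightarrow> nat \<Rightarrow> (real \<times> (nat \<Rightarrow> nat \<Rightarrow> real)) measure" where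
  "unobserved n i = lborel \<Otimes>\<^sub>M (\<Pi>\<^sub>M j\<in>{1..n} - {i}. obs_space n)"

definition translate_profile ::
  "nat \<Rightarrow> nat \<Rightarrow> real \<Rightarrow> (nat \<Rightarrow> nat \<Rightarrow> real) \<Rightarrow> real \<times> (nat \<Rightarrow> nat \<Rightarrow> real) \<Rightarrow> real \<times> (nat \<Rightarrow> nat \<Rightarrow> real)"
  where "translate_profile n i a S z = (fst z + a, \<lambda>j\<in>{1..n} - {i}. translate n (S j) (snd z j))"

lemma measurable_unobserved_component [measurable]:
  assumes "j \<in> {1..n} - {i}"
  shows "(\<lambda>z. snd z j) \<in> unobserved n i \<rightarrow>\<^sub>M obs_space n"
  unfolding unobserved_def using assms
  by (intro measurable_compose[OF measurable_snd measurable_component_singleton])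

lemma measurable_unobserved_fst [measurable]: "fst \<in> borel_measurable (unobserved n i)"
  unfolding unobserved_def by measurable

lemma measurable_translate_profile [measurable]:
  "translate_profile n i a S \<in> unobserved n i \<rightarrow>\<^sub>M unobserved n i"
proof -
  have "(\<lambda>z. \<lambda>j\<in>{1..n} - {i}. translate n (S j) (snd z j))
      \<in> unobserved n i \<rightarrow>\<^sub>M (\<Pi>\<^sub>M j\<in>{1..n} - {i}. obs_space n)"
    by (intro measurable_restrict measurable_compose[OF measurable_unobserved_component measurable_translate])
  then have "(\<lambda>z. (fst z + a, \<lambda>j\<in>{1..n} - {i}. translate n (S j) (snd z j)))
      \<in> unobserved n i \<rightarrow>\<^sub>M lborel \<Otimes>\<^sub>M (\<Pi>\<^sub>M j\<in>{1..n} - {i}. obs_space n)"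
    by (intro measurable_Pair) simp_all
  then show ?thesis
    unfolding translate_profile_def[abs_def] by (subst (2) unobserved_def)
qed

text \<open>Pushing a density forward along such a shift therefore only composes it with the inverse
  shift, with no Jacobian factor.\<close>

lemma distr_translate_profile:
  "distr (unobserved n i) (unobserved n i) (translate_profile n i a S) = unobserved n i"
proof -
  let ?K = "{1..n} - {i}"
  let ?P = "\<Pi>\<^sub>M j\<in>?K. obs_space n"
  let ?g = "\<lambda>Y. \<lambda>j\<in>?K. translate n (S j) (Y j)"
  have sf: "sigma_finite_measure ?P"
    by (intro product_sigma_finite.sigma_finite product_sigma_finite_obs_space) simp
  have d2: "distr ?P ?P ?g = ?P"
    by (intro distr_PiM_componentwise_invariant product_sigma_finite_obs_space distr_translate) simp_all
  have d1: "distr lborel lborel (\<lambda>x. x + a) = lborel"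
    by (rule distr_lborel_add)
  have mg: "?g \<in> ?P \<rightarrow>\<^sub>M ?P"
    by (intro measurable_restrict measurable_compose[OF _ measurable_translate] measurable_component_singleton)
  have "distr lborel lborel (\<lambda>x. x + a) \<Otimes>\<^sub>M distr ?P ?P ?g =
      distr (lborel \<Otimes>\<^sub>M ?P) (lborel \<Otimes>\<^sub>M ?P) (\<lambda>(x, y). (x + a, ?g y))"
    by (intro pair_measure_distr mg) (simp, simp only: d2 sf)
  moreover have "(\<lambda>(x, y). (x + a, ?g y)) = translate_profile n i a S"
    by (auto simp: translate_profile_def)
  ultimately show ?thesis
    unfolding d1 d2 unobserved_def by simp
qed

section \<open>The joint density under a shift by conditional means\<close>

text \<open>Expanding the square isolates what a shift does to the exponent. The factor depends on
  \<open>b - a\<close> only and is 1 when mean and argument move together.\<close>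

lemma normal_density_translate:
  "normal_density (m + a) s (x + b) =
   normal_density m s x * exp (- (2 * (x - m) * (b - a) + (b - a)\<^sup>2) / (2 * s\<^sup>2))"
proof -
  have "(x + b - (m + a))\<^sup>2 = (x - m)\<^sup>2 + (2 * (x - m) * (b - a) + (b - a)\<^sup>2)"
    by (simp add: power2_eq_square algebra_simps)
  then have "- (x + b - (m + a))\<^sup>2 / (2 * s\<^sup>2) =
      - (x - m)\<^sup>2 / (2 * s\<^sup>2) + - (2 * (x - m) * (b - a) + (b - a)\<^sup>2) / (2 * s\<^sup>2)"
    by (simp add: diff_divide_distrib add_divide_distrib)
  then show ?thesis
    by (simp only: normal_density_def exp_add mult.assoc)
qed

text \<open>Turns sums over the report positions of agent \<open>i\<close> into sums over the other
  agents.\<close>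

lemma bij_betw_source_fixed:
  assumes "i \<in> {1..n}"
  shows "bij_betw (source i) {2..n} ({1..n} - {i})"
proof -
  have "inj_on (source i) {2..n}"
    by (auto simp: inj_on_def source_def split: if_splits)
  moreover have "source i ` {2..n} = {1..n} - {i}"
  proof (intro equalityI subsetI)
    fix j assume "j \<in> {1..n} - {i}"
    then have "j = source i (if j < i then j + 1 else j)" "(if j < i then j + 1 else j) \<in> {2..n}"
      using assms by (auto simp: source_def)
    then show "j \<in> source i ` {2..n}" by blast
  qed (use assms in \<open>auto simp: source_def\<close>)
  ultimately show ?thesis by (simp add: bij_betw_def)
qed

locale noisy_sharing =
  fixes n :: nat and \<sigma> \<tau> :: real
  assumes n_ge_2: "n \<ge> 2" and \<sigma>_pos: "\<sigma> > 0" and \<tau>_pos: "\<tau> > 0"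
begin

text \<open>The weight of the report in the conditional mean of another agent's signal given
  \<theta> and the report. It is also the precision of a report about \<theta> relative to that of
  the own signal.\<close>

definition \<rho> :: real where "\<rho> = \<sigma>\<^sup>2 / (\<sigma>\<^sup>2 + \<tau>\<^sup>2)"

lemma \<rho>_pos: "\<rho> > 0" and \<rho>_less_1: "\<rho> < 1"
  using \<sigma>_pos \<tau>_pos by (auto simp: \<rho>_def field_simps add_pos_pos)

text \<open>Both ratios equal the precision of a report about \<theta>; this equality produces the
  cancellation in \<open>coupling\<close> below.\<close>

lemma \<rho>_over_var: "\<rho> / \<sigma>\<^sup>2 = 1 / (\<sigma>\<^sup>2 + \<tau>\<^sup>2)" "(1 - \<rho>) / \<tau>\<^sup>2 = 1 / (\<sigma>\<^sup>2 + \<tau>\<^sup>2)"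
proof -
  have "\<sigma>\<^sup>2 > 0" "\<tau>\<^sup>2 > 0" using \<sigma>_pos \<tau>_pos by auto
  then have *: "\<sigma>\<^sup>2 + \<tau>\<^sup>2 \<noteq> 0" "\<sigma>\<^sup>2 \<noteq> 0" "\<tau>\<^sup>2 \<noteq> 0" by linarith+
  then show "\<rho> / \<sigma>\<^sup>2 = 1 / (\<sigma>\<^sup>2 + \<tau>\<^sup>2)" by (simp add: \<rho>_def)
  have "1 - \<rho> = \<tau>\<^sup>2 / (\<sigma>\<^sup>2 + \<tau>\<^sup>2)" using * by (simp add: \<rho>_def field_simps)
  then show "(1 - \<rho>) / \<tau>\<^sup>2 = 1 / (\<sigma>\<^sup>2 + \<tau>\<^sup>2)" using * by simp
qed

text \<open>The precision-weighted average of the signals, which is the estimate of \<theta> under a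
  flat prior. The proof uses it only for increments of the posterior mean.\<close>

definition wmean :: "(nat \<Rightarrow> real) \<Rightarrow> real" where
  "wmean v = (v 1 + \<rho> * (\<Sum>p\<in>{2..n}. v p)) / (1 + real (n - 1) * \<rho>)"

lemma wmean_denom_pos: "1 + real (n - 1) * \<rho> > 0"
  using \<rho>_pos by (simp add: add_pos_nonneg)

text \<open>The first-order condition of weighted least squares; it makes the terms linear in
  \<theta> vanish from the exponent.\<close>

lemma wmean_residual: "(v 1 - wmean v) + \<rho> * (\<Sum>p\<in>{2..n}. v p - wmean v) = 0"
proof -
  have "wmean v * (1 + real (n - 1) * \<rho>) = v 1 + \<rho> * (\<Sum>p\<in>{2..n}. v p)"
    using wmean_denom_pos by (simp add: wmean_def)
  then show ?thesis
    by (simp add: sum_subtractf algebra_simps)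
qed

text \<open>The conditional expectation of \<open>x\<^sub>k\<close> given \<open>y\<^sub>i = v\<close>; \<open>y\<^sub>k\<^sub>i\<close> sits at position \<open>inv_into {2..n} (source i) k\<close>.\<close>

definition predicted :: "nat \<Rightarrow> (nat \<Rightarrow> real) \<Rightarrow> nat \<Rightarrow> real" where
  "predicted i v k =
     (if k = i then v 1 else (1 - \<rho>) * wmean v + \<rho> * v (inv_into {2..n} (source i) k))"

lemma predicted_own: "predicted i v i = v 1"
  by (simp add: predicted_def)

lemma predicted_source:
  assumes "i \<in> {1..n}" "p \<in> {2..n}"
  shows "predicted i v (source i p) = (1 - \<rho>) * wmean v + \<rho> * v p"
proof -
  have "source i p \<noteq> i"
    using bij_betwE[OF bij_betw_source_fixed[OF assms(1)]] assms(2) by blast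
  moreover have "inv_into {2..n} (source i) (source i p) = p"
    using assms bij_betw_source_fixed[OF assms(1)] by (simp add: bij_betw_def)
  ultimately show ?thesis by (simp add: predicted_def)
qed

text \<open>A report to an agent \<open>j\<close> other than \<open>i\<close> carries extra noise
  with conditional mean 0, so it moves exactly as much as the signal of its source.\<close>

abbreviation posterior_shift ::
  "nat \<Rightarrow> (nat \<Rightarrow> real) \<Rightarrow> real \<times> (nat \<Rightarrow> nat \<Rightarrow> real) \<Rightarrow> real \<times> (nat \<Rightarrow> nat \<Rightarrow> real)" where
  "posterior_shift i v \<equiv> translate_profile n i (wmean v) (\<lambda>j p. predicted i v (source j p))"

text \<open>
  The posterior of a Gaussian model depends on the observation through its mean only: moving every
  unobserved variable by its conditional expectation given \<open>y\<^sub>i = v\<close> cancels the terms of the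
  exponent that mix \<open>v\<close> with unobserved variables.
\<close>

lemma joint_density_translate:
  assumes i: "i \<in> {1..n}"
  shows "\<exists>C>0. \<forall>z. joint_density n \<sigma> \<tau> (fst (posterior_shift i v z))
      ((snd (posterior_shift i v z))(i := translate n v u)) =
      C * joint_density n \<sigma> \<tau> (fst z) ((snd z)(i := u))"
proof -
  let ?N = "{1..n}" and ?Q = "{2..n}"
  define a where "a = wmean v"
  define w where "w = 1 / (\<sigma>\<^sup>2 + \<tau>\<^sup>2)"
  define e where "e p = v p - a" for p
  \<comment> \<open>The part of the change of the exponent that involves only \<open>u\<close> and
    \<open>v\<close>; it becomes the constant factor \<open>exp (- c)\<close>.\<close>
  define c where "c = (2 * u 1 * e 1 + (e 1)\<^sup>2) / (2 * \<sigma>\<^sup>2) + (\<Sum>p\<in>?Q. w * (2 * u p * e p + (e p)\<^sup>2) / 2)"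
  \<comment> \<open>The shift applied to position \<open>p\<close> of the observation of
    \<open>k\<close>: the given \<open>v\<close> for agent \<open>i\<close>, a prediction for
    everybody else.\<close>
  define D where "D k p = (if k = i then v p else predicted i v (source k p))" for k p
  have src: "source k p \<in> ?N" if "k \<in> ?N" "p \<in> ?N" for k p
    using that by (auto simp: source_def)
  have src1: "source k 1 = k" for k by (simp add: source_def)
  have D1: "D k 1 = predicted i v k" for k
    by (cases "k = i") (simp_all only: D_def src1 predicted_own simp_thms if_True if_False)
  have "joint_density n \<sigma> \<tau> (\<theta> + a)
      ((\<lambda>j\<in>?N - {i}. translate n (\<lambda>p. predicted i v (source j p)) (Y j))(i := translate n v u)) =
      exp (- c) * joint_density n \<sigma> \<tau> \<theta> (Y(i := u))" for \<theta> Y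
  proof -
    define y where "y = Y(i := u)"
    define x where "x k = y k 1" for k
    define y' where "y' = (\<lambda>j\<in>?N - {i}. translate n (\<lambda>p. predicted i v (source j p)) (Y j))(i := translate n v u)"
    have y': "y' k p = y k p + D k p" if "k \<in> ?N" "p \<in> ?N" for k p
      using that by (auto simp: y'_def y_def D_def translate_def)
    \<comment> \<open>\<open>E1\<close> and \<open>F\<close> collect the exponents of the correction
      factors of \<open>normal_density_translate\<close>, for private signals and for reports
      respectively.\<close>
    define E1 where "E1 = (\<Sum>k\<in>?N. - (2 * (x k - \<theta>) * (D k 1 - a) + (D k 1 - a)\<^sup>2) / (2 * \<sigma>\<^sup>2))"
    define F where "F k p = - (2 * (y k p - x (source k p)) * (D k p - D (source k p) 1)
        + (D k p - D (source k p) 1)\<^sup>2) / (2 * \<tau>\<^sup>2)" for k p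
    have P1: "(\<Prod>k\<in>?N. normal_density (\<theta> + a) \<sigma> (y' k 1)) =
        (\<Prod>k\<in>?N. normal_density \<theta> \<sigma> (y k 1)) * exp E1"
      unfolding E1_def exp_sum[OF finite_atLeastAtMost] prod.distrib[symmetric]
      using n_ge_2 by (intro prod.cong refl) (simp add: y' normal_density_translate x_def)
    have "(\<Prod>k\<in>?N. \<Prod>p\<in>?Q. normal_density (y' (source k p) 1) \<tau> (y' k p)) =
        (\<Prod>k\<in>?N. \<Prod>p\<in>?Q. normal_density (y (source k p) 1) \<tau> (y k p) * exp (F k p))"
      using src n_ge_2
      by (intro prod.cong refl) (simp add: y' normal_density_translate x_def F_def)
    also have "\<dots> = (\<Prod>k\<in>?N. \<Prod>p\<in>?Q. normal_density (y (source k p) 1) \<tau> (y k p)) *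
        exp (\<Sum>k\<in>?N. \<Sum>p\<in>?Q. F k p)"
      by (simp add: prod.distrib exp_sum)
    \<comment> \<open>For \<open>k \<noteq> i\<close> a report and its source signal move by the
      same amount, so the factor is unchanged. Only the reports read by agent \<open>i\<close>
      contribute.\<close>
    also have "(\<Sum>k\<in>?N. \<Sum>p\<in>?Q. F k p) = (\<Sum>p\<in>?Q. F i p)"
    proof -
      have "(\<Sum>p\<in>?Q. F k p) = 0" if "k \<noteq> i" for k
        using that by (simp only: F_def D1) (simp add: D_def)
      then have "(\<Sum>k\<in>?N. \<Sum>p\<in>?Q. F k p) = (\<Sum>k\<in>{i}. \<Sum>p\<in>?Q. F k p)"
        using i by (intro sum.mono_neutral_right) auto
      then show ?thesis by simp
    qed
    finally have P2: "(\<Prod>k\<in>?N. \<Prod>p\<in>?Q. normal_density (y' (source k p) 1) \<tau> (y' k p)) =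
        (\<Prod>k\<in>?N. \<Prod>p\<in>?Q. normal_density (y (source k p) 1) \<tau> (y k p)) * exp (\<Sum>p\<in>?Q. F i p)" .
    have "E1 = - (2 * (x i - \<theta>) * (D i 1 - a) + (D i 1 - a)\<^sup>2) / (2 * \<sigma>\<^sup>2) +
        (\<Sum>k\<in>?N - {i}. - (2 * (x k - \<theta>) * (D k 1 - a) + (D k 1 - a)\<^sup>2) / (2 * \<sigma>\<^sup>2))"
      unfolding E1_def using i by (subst sum.remove[of _ i]) simp_all
    also have "(\<Sum>k\<in>?N - {i}. - (2 * (x k - \<theta>) * (D k 1 - a) + (D k 1 - a)\<^sup>2) / (2 * \<sigma>\<^sup>2)) =
        (\<Sum>p\<in>?Q. - (2 * (x (source i p) - \<theta>) * (D (source i p) 1 - a) + (D (source i p) 1 - a)\<^sup>2) / (2 * \<sigma>\<^sup>2))"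
      by (rule sum.reindex_bij_betw[OF bij_betw_source_fixed[OF i], symmetric])
    also have "- (2 * (x i - \<theta>) * (D i 1 - a) + (D i 1 - a)\<^sup>2) / (2 * \<sigma>\<^sup>2) =
        - (2 * (u 1 - \<theta>) * e 1 + (e 1)\<^sup>2) / (2 * \<sigma>\<^sup>2)"
      by (simp add: x_def y_def D_def e_def)
    finally have E1: "E1 + (\<Sum>p\<in>?Q. F i p) = - (2 * (u 1 - \<theta>) * e 1 + (e 1)\<^sup>2) / (2 * \<sigma>\<^sup>2) +
      (\<Sum>p\<in>?Q. - (2 * (x (source i p) - \<theta>) * (D (source i p) 1 - a) + (D (source i p) 1 - a)\<^sup>2) / (2 * \<sigma>\<^sup>2)
         + F i p)"
      by (simp add: sum.distrib)
    \<comment> \<open>The signal \<open>X\<close> of the source is tied to \<theta> with variance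
      \<open>\<sigma>\<^sup>2\<close> and to the report \<open>u p\<close> with variance
      \<open>\<tau>\<^sup>2\<close>. By \<open>\<rho>_over_var\<close> its two cross terms have
      opposite coefficients and cancel.\<close>
    have coupling: "- (2 * (x (source i p) - \<theta>) * (D (source i p) 1 - a) + (D (source i p) 1 - a)\<^sup>2) / (2 * \<sigma>\<^sup>2)
         + F i p = \<theta> * w * e p - w * (2 * u p * e p + (e p)\<^sup>2) / 2" if p: "p \<in> ?Q" for p
    proof -
      define X where "X = x (source i p)"
      have Dp: "D (source i p) 1 = (1 - \<rho>) * a + \<rho> * v p"
        by (simp only: D1 predicted_source[OF i p] a_def)
      have h: "D (source i p) 1 - a = \<rho> * e p"
        unfolding Dp by (simp add: e_def algebra_simps)
      have g: "D i p - D (source i p) 1 = (1 - \<rho>) * e p"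
        unfolding Dp by (simp add: e_def D_def algebra_simps)
      have "- (2 * (X - \<theta>) * (\<rho> * e p) + (\<rho> * e p)\<^sup>2) / (2 * \<sigma>\<^sup>2) =
          - (\<rho> / \<sigma>\<^sup>2) * (2 * (X - \<theta>) * e p + \<rho> * (e p)\<^sup>2) / 2"
        by (simp add: power2_eq_square algebra_simps diff_divide_distrib add_divide_distrib)
      moreover have "- (2 * (u p - X) * ((1 - \<rho>) * e p) + ((1 - \<rho>) * e p)\<^sup>2) / (2 * \<tau>\<^sup>2) =
          - ((1 - \<rho>) / \<tau>\<^sup>2) * (2 * (u p - X) * e p + (1 - \<rho>) * (e p)\<^sup>2) / 2"
        using \<tau>_pos by (simp add: power2_eq_square field_simps)
      moreover have "F i p = - (2 * (u p - X) * ((1 - \<rho>) * e p) + ((1 - \<rho>) * e p)\<^sup>2) / (2 * \<tau>\<^sup>2)"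
        by (simp only: F_def g X_def y_def fun_upd_same)
      ultimately show ?thesis
        unfolding h X_def[symmetric] \<rho>_over_var w_def[symmetric]
        by (simp add: algebra_simps diff_divide_distrib add_divide_distrib)
    qed
    \<comment> \<open>This is the total coefficient of \<theta>, a multiple of the expression in
      \<open>wmean_residual\<close>.\<close>
    have "e 1 / \<sigma>\<^sup>2 + w * (\<Sum>p\<in>?Q. e p) = (e 1 + \<rho> * (\<Sum>p\<in>?Q. e p)) / \<sigma>\<^sup>2"
      by (simp add: add_divide_distrib w_def \<rho>_over_var(1)[symmetric])
    also have "\<dots> = 0" using wmean_residual[of v] by (simp add: e_def a_def)
    finally have z: "\<theta> * (e 1 / \<sigma>\<^sup>2 + w * (\<Sum>p\<in>?Q. e p)) = 0" by simp
    have "E1 + (\<Sum>p\<in>?Q. F i p) = - (2 * (u 1 - \<theta>) * e 1 + (e 1)\<^sup>2) / (2 * \<sigma>\<^sup>2) +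
        (\<Sum>p\<in>?Q. \<theta> * w * e p - w * (2 * u p * e p + (e p)\<^sup>2) / 2)"
      unfolding E1 by (simp only: coupling cong: sum.cong)
    also have "\<dots> = \<theta> * (e 1 / \<sigma>\<^sup>2 + w * (\<Sum>p\<in>?Q. e p)) - c"
      using \<sigma>_pos unfolding c_def sum_subtractf sum_distrib_left[symmetric] mult.assoc
      by (simp add: field_simps)
    finally have "E1 + (\<Sum>p\<in>?Q. F i p) = - c" using z by simp
    then have "exp E1 * exp (\<Sum>p\<in>?Q. F i p) = exp (- c)"
      by (simp add: exp_add[symmetric])
    then show ?thesis
      unfolding joint_density_def y'_def[symmetric] y_def[symmetric] P1 P2 by (simp add: algebra_simps)
  qed
  then show ?thesis
    by (intro exI[of _ "exp (- c)"]) (simp add: translate_profile_def a_def)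
qed

section \<open>Normalizability and first moment of the posterior\<close>

definition unnormalized :: "nat \<Rightarrow> (nat \<Rightarrow> real) \<Rightarrow> real \<times> (nat \<Rightarrow> nat \<Rightarrow> real) \<Rightarrow> real" where
  "unnormalized i u z = joint_density n \<sigma> \<tau> (fst z) ((snd z)(i := u))"

definition evidence :: "nat \<Rightarrow> (nat \<Rightarrow> real) \<Rightarrow> ennreal" where
  "evidence i u = (\<integral>\<^sup>+z. ennreal (unnormalized i u z) \<partial>unobserved n i)"

lemma posterior_eq:
  "posterior n \<sigma> \<tau> i u = density (unobserved n i) (\<lambda>z. ennreal (unnormalized i u z) / evidence i u)"
  by (simp add: posterior_def unobserved_def unnormalized_def evidence_def Let_def case_prod_beta')

lemma joint_density_pos: "joint_density n \<sigma> \<tau> \<theta> Y > 0"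
  unfolding joint_density_def using \<sigma>_pos \<tau>_pos
  by (intro mult_pos_pos prod_pos normal_density_pos ballI) auto

lemma unnormalized_pos: "unnormalized i u z > 0"
  by (simp add: unnormalized_def joint_density_pos)

lemma measurable_unnormalized [measurable]:
  "unnormalized i u \<in> borel_measurable (unobserved n i)"
proof -
  have comp: "(\<lambda>z. ((snd z)(i := u)) k p) \<in> borel_measurable (unobserved n i)"
    if "k \<in> {1..n}" "p \<in> {1..n}" for k p
    using that measurable_obs_space_component[OF that(2) measurable_unobserved_component, of k i]
    by (cases "k = i") auto
  show ?thesis
    unfolding unnormalized_def[abs_def] joint_density_def
    by (intro borel_measurable_times borel_measurable_prod borel_measurable_normal_density2
        measurable_unobserved_fst comp) (use n_ge_2 in \<open>auto simp: source_def\<close>)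
qed

text \<open>
  The factors \<open>normal_density (x\<^sub>j) \<tau> (u p)\<close> are bounded; all others but that of \<open>u 1\<close> integrate to 1,
  the shared signals first.
\<close>

lemma nn_integral_joint_density_le:
  assumes i: "i \<in> {1..n}"
  shows "\<exists>C\<ge>0. \<forall>\<theta>. (\<integral>\<^sup>+Y. ennreal (joint_density n \<sigma> \<tau> \<theta> (Y(i := u))) \<partial>(\<Pi>\<^sub>M j\<in>{1..n} - {i}. obs_space n))
    \<le> ennreal (C * normal_density (u 1) \<sigma> \<theta>)"
proof (intro exI conjI allI)
  let ?N = "{1..n}" and ?Q = "{2..n}"
  let ?K = "?N - {i}"
  let ?A = "?K \<times> {1::nat}" and ?B = "?K \<times> ?Q"
  \<comment> \<open>The peak value of a normal density with standard deviation \<tau>; each of the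
    \<open>n - 1\<close> reports seen by agent \<open>i\<close> is bounded by it.\<close>
  define c where "c = 1 / sqrt (2 * pi * \<tau>\<^sup>2)"
  show "0 \<le> c ^ (n - 1)" by (simp add: c_def)
  fix \<theta> :: real
  interpret L: product_sigma_finite "\<lambda>_::nat \<times> nat. (lborel :: real measure)"
    by (rule product_sigma_finite_lborel)
  let ?h = "\<lambda>Y. ennreal (joint_density n \<sigma> \<tau> \<theta> (Y(i := u)))"
  let ?c = "\<lambda>w :: nat \<times> nat \<Rightarrow> real. \<lambda>k\<in>?K. \<lambda>p\<in>?N. w (k, p)"
  let ?xi = "\<lambda>v k. if k = i then u 1 else v (k, 1::nat)"
  let ?U = "normal_density (u 1) \<sigma> \<theta>"
  let ?R1 = "\<lambda>v. \<Prod>l\<in>?A. normal_density \<theta> \<sigma> (v l)"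
  let ?R2 = "\<lambda>v z. \<Prod>l\<in>?B. normal_density (?xi v (source (fst l) (snd l))) \<tau> (z l)"
  have c0: "c \<ge> 0" by (simp add: c_def)
  have c: "normal_density m \<tau> x \<le> c" for m x
    using \<tau>_pos by (auto simp: normal_density_def c_def intro!: mult_left_le divide_right_mono)
  have mh: "?h \<in> borel_measurable (\<Pi>\<^sub>M k\<in>?K. \<Pi>\<^sub>M p\<in>?N. lborel)"
  proof -
    have "Pair \<theta> \<in> (\<Pi>\<^sub>M k\<in>?K. obs_space n) \<rightarrow>\<^sub>M unobserved n i"
      unfolding unobserved_def by simp
    from measurable_compose[OF this measurable_unnormalized[of i u]]
    show ?thesis by (simp add: unnormalized_def obs_space_def)
  qed
  have bound: "joint_density n \<sigma> \<tau> \<theta> ((?c (merge ?A ?B (v, z)))(i := u)) \<le>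
      c ^ (n - 1) * ?U * ?R1 v * ?R2 v z" for v z
  proof -
    define y where "y = (?c (merge ?A ?B (v, z)))(i := u)"
    have y1: "y k 1 = ?xi v k" if "k \<in> ?N" for k
      using that by (auto simp: y_def merge_def)
    have yp: "y k p = z (k, p)" if "k \<in> ?K" "p \<in> ?Q" for k p
      using that by (auto simp: y_def merge_def)
    have src: "source k p \<in> ?N" if "k \<in> ?N" "p \<in> ?Q" for k p
      using that by (auto simp: source_def)
    have "(\<Prod>k\<in>?N. normal_density \<theta> \<sigma> (y k 1)) =
        normal_density \<theta> \<sigma> (u 1) * (\<Prod>k\<in>?K. normal_density \<theta> \<sigma> (y k 1))"
      using i by (subst prod.remove[of _ i]) (auto simp: y_def)
    also have "(\<Prod>k\<in>?K. normal_density \<theta> \<sigma> (y k 1)) = (\<Prod>k\<in>?K. \<Prod>p\<in>{1::nat}. normal_density \<theta> \<sigma> (v (k, p)))"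
      by (intro prod.cong) (use y1 in auto)
    also have "\<dots> = ?R1 v"
      unfolding prod.cartesian_product by (intro prod.cong) auto
    \<comment> \<open>Mean and argument are interchangeable, so this factor reads as a density in
      \<theta> centred at the own signal.\<close>
    also have "normal_density \<theta> \<sigma> (u 1) = ?U"
      by (simp add: normal_density_def power2_commute)
    finally have P1: "(\<Prod>k\<in>?N. normal_density \<theta> \<sigma> (y k 1)) = ?U * ?R1 v" .
    have "(\<Prod>k\<in>?N. \<Prod>p\<in>?Q. normal_density (y (source k p) 1) \<tau> (y k p)) =
        (\<Prod>p\<in>?Q. normal_density (y (source i p) 1) \<tau> (y i p)) *
        (\<Prod>k\<in>?K. \<Prod>p\<in>?Q. normal_density (y (source k p) 1) \<tau> (y k p))"
      using i by (subst prod.remove[of _ i]) auto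
    also have "(\<Prod>k\<in>?K. \<Prod>p\<in>?Q. normal_density (y (source k p) 1) \<tau> (y k p)) =
        (\<Prod>k\<in>?K. \<Prod>p\<in>?Q. normal_density (?xi v (source k p)) \<tau> (z (k, p)))"
      using y1[OF src] yp by (intro prod.cong refl arg_cong2[where f = "\<lambda>m. normal_density m \<tau>"]) auto
    also have "\<dots> = ?R2 v z"
      unfolding prod.cartesian_product by (intro prod.cong) auto
    finally have "(\<Prod>k\<in>?N. \<Prod>p\<in>?Q. normal_density (y (source k p) 1) \<tau> (y k p)) =
        (\<Prod>p\<in>?Q. normal_density (y (source i p) 1) \<tau> (y i p)) * ?R2 v z" .
    also have "\<dots> \<le> (\<Prod>p\<in>?Q. c) * ?R2 v z"
      by (intro mult_right_mono prod_mono prod_nonneg) (simp_all add: c)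
    finally have "(\<Prod>k\<in>?N. \<Prod>p\<in>?Q. normal_density (y (source k p) 1) \<tau> (y k p)) \<le> c ^ (n - 1) * ?R2 v z"
      by simp
    then have "joint_density n \<sigma> \<tau> \<theta> y \<le> (?U * ?R1 v) * (c ^ (n - 1) * ?R2 v z)"
      unfolding joint_density_def P1 by (intro mult_left_mono mult_nonneg_nonneg prod_nonneg) auto
    then show ?thesis by (simp add: y_def mult.assoc mult.left_commute)
  qed
  have mR: "(\<lambda>x. ennreal (\<Prod>l\<in>I. normal_density (m l) s (x l))) \<in> borel_measurable (\<Pi>\<^sub>M l\<in>I. lborel)"
    for I :: "(nat \<times> nat) set" and m s
  proof -
    have "(\<lambda>x. x l) \<in> borel_measurable (\<Pi>\<^sub>M l\<in>I. (lborel :: real measure))" if "l \<in> I" for l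
      using measurable_component_singleton[OF that, of "\<lambda>_. lborel :: real measure"] by simp
    then show ?thesis
      by (intro measurable_compose[OF _ measurable_ennreal] borel_measurable_prod
          borel_measurable_normal_density2) simp_all
  qed
  have one: "(\<integral>\<^sup>+x. ennreal (\<Prod>l\<in>I. normal_density (m l) s (x l)) \<partial>(\<Pi>\<^sub>M l\<in>I. lborel)) = 1"
    if "finite I" "s > 0" for I :: "(nat \<times> nat) set" and m s
  proof -
    have n1: "(\<integral>\<^sup>+x. ennreal (normal_density a s x) \<partial>lborel) = 1" for a
      using prob_space.emeasure_space_1[OF prob_space_normal_density[OF that(2), of a]]
      by (simp add: emeasure_density)
    have "(\<integral>\<^sup>+x. ennreal (\<Prod>l\<in>I. normal_density (m l) s (x l)) \<partial>(\<Pi>\<^sub>M l\<in>I. lborel)) =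
        (\<integral>\<^sup>+x. (\<Prod>l\<in>I. ennreal (normal_density (m l) s (x l))) \<partial>(\<Pi>\<^sub>M l\<in>I. lborel))"
      by (simp add: prod_ennreal)
    also have "\<dots> = (\<Prod>l\<in>I. \<integral>\<^sup>+x. ennreal (normal_density (m l) s x) \<partial>lborel)"
      using that by (intro L.product_nn_integral_prod) auto
    finally show ?thesis by (simp add: n1)
  qed
  \<comment> \<open>\<open>?A\<close> indexes the private signals of the others and
    \<open>?B\<close> the reports they receive. The means in \<open>?R2\<close> depend on
    \<open>v\<close> only, so its integral over \<open>z\<close> is 1 for every fixed
    \<open>v\<close>.\<close>
  have un: "?K \<times> ?N = ?A \<union> ?B" using n_ge_2 by auto
  have mc: "?c \<in> (\<Pi>\<^sub>M l\<in>?K \<times> ?N. lborel) \<rightarrow>\<^sub>M (\<Pi>\<^sub>M k\<in>?K. \<Pi>\<^sub>M p\<in>?N. lborel)"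
    by (intro measurable_restrict measurable_component_singleton) auto
  have "(\<integral>\<^sup>+Y. ?h Y \<partial>(\<Pi>\<^sub>M j\<in>?K. obs_space n)) = (\<integral>\<^sup>+w. ?h (?c w) \<partial>(\<Pi>\<^sub>M l\<in>?K \<times> ?N. lborel))"
    unfolding obs_space_def by (intro nn_integral_PiM_curry[symmetric] mh) auto
  also have "\<dots> = (\<integral>\<^sup>+v. (\<integral>\<^sup>+z. ?h (?c (merge ?A ?B (v, z))) \<partial>(\<Pi>\<^sub>M l\<in>?B. lborel)) \<partial>(\<Pi>\<^sub>M l\<in>?A. lborel))"
    using measurable_compose[OF mc mh] unfolding un
    by (intro L.product_nn_integral_fold) auto
  also have "\<dots> \<le> (\<integral>\<^sup>+v. (\<integral>\<^sup>+z. ennreal (c ^ (n - 1) * ?U * ?R1 v) * ennreal (?R2 v z)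
      \<partial>(\<Pi>\<^sub>M l\<in>?B. lborel)) \<partial>(\<Pi>\<^sub>M l\<in>?A. lborel))"
    using c0 bound
    by (intro nn_integral_mono) (auto simp: ennreal_mult[symmetric] prod_nonneg intro!: ennreal_leI)
  also have "\<dots> = (\<integral>\<^sup>+v. ennreal (c ^ (n - 1) * ?U * ?R1 v) \<partial>(\<Pi>\<^sub>M l\<in>?A. lborel))"
    using \<tau>_pos by (intro nn_integral_cong, subst nn_integral_cmult[OF mR]) (simp_all add: one)
  also have "\<dots> = (\<integral>\<^sup>+v. ennreal (c ^ (n - 1) * ?U) * ennreal (?R1 v) \<partial>(\<Pi>\<^sub>M l\<in>?A. lborel))"
    using c0 by (intro nn_integral_cong) (auto simp: ennreal_mult[symmetric] prod_nonneg)
  also have "\<dots> = ennreal (c ^ (n - 1) * ?U)"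
    using \<sigma>_pos by (subst nn_integral_cmult[OF mR]) (simp_all add: one)
  finally show "(\<integral>\<^sup>+Y. ?h Y \<partial>(\<Pi>\<^sub>M j\<in>?K. obs_space n)) \<le> ennreal (c ^ (n - 1) * ?U)" .
qed

text \<open>By Tonelli and the preceding bound, \<theta> has marginal density at most a constant
  times a Gaussian. Taking \<open>g\<close> to be 1 gives a finite normalizing constant, and the
  absolute value gives the first moment.\<close>

lemma nn_integral_unnormalized_finite:
  assumes i: "i \<in> {1..n}" and [measurable]: "g \<in> borel_measurable borel"
    and g0: "\<And>\<theta>. g \<theta> \<ge> 0"
    and int: "integrable lborel (\<lambda>\<theta>. normal_density (u 1) \<sigma> \<theta> * g \<theta>)"
  shows "(\<integral>\<^sup>+z. ennreal (g (fst z)) * ennreal (unnormalized i u z) \<partial>unobserved n i) < \<infinity>"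
proof -
  let ?P = "\<Pi>\<^sub>M j\<in>{1..n} - {i}. obs_space n"
  obtain C where C: "C \<ge> 0" "\<And>\<theta>. (\<integral>\<^sup>+Y. ennreal (joint_density n \<sigma> \<tau> \<theta> (Y(i := u))) \<partial>?P)
    \<le> ennreal (C * normal_density (u 1) \<sigma> \<theta>)"
    using nn_integral_joint_density_le[OF i, of u] by blast
  interpret P: sigma_finite_measure ?P
    by (intro product_sigma_finite.sigma_finite product_sigma_finite_obs_space) simp
  have "(\<lambda>z. ennreal (g (fst z)) * ennreal (unnormalized i u z)) \<in> borel_measurable (unobserved n i)"
    by measurable
  then have "(\<integral>\<^sup>+z. ennreal (g (fst z)) * ennreal (unnormalized i u z) \<partial>unobserved n i) =
      (\<integral>\<^sup>+\<theta>. (\<integral>\<^sup>+Y. ennreal (g \<theta>) * ennreal (unnormalized i u (\<theta>, Y)) \<partial>?P) \<partial>lborel)"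
    unfolding unobserved_def by (subst P.nn_integral_fst[symmetric]) simp_all
  also have "\<dots> = (\<integral>\<^sup>+\<theta>. ennreal (g \<theta>) * (\<integral>\<^sup>+Y. ennreal (unnormalized i u (\<theta>, Y)) \<partial>?P) \<partial>lborel)"
  proof (intro nn_integral_cong nn_integral_cmult)
    fix \<theta> :: real
    have "Pair \<theta> \<in> ?P \<rightarrow>\<^sub>M unobserved n i" unfolding unobserved_def by simp
    from measurable_compose[OF this measurable_unnormalized[of i u]]
    show "(\<lambda>Y. ennreal (unnormalized i u (\<theta>, Y))) \<in> borel_measurable ?P" by simp
  qed
  also have "\<dots> \<le> (\<integral>\<^sup>+\<theta>. ennreal (g \<theta>) * ennreal (C * normal_density (u 1) \<sigma> \<theta>) \<partial>lborel)"
    using C(2) by (intro nn_integral_mono mult_left_mono) (auto simp: unnormalized_def)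
  also have "\<dots> = (\<integral>\<^sup>+\<theta>. ennreal (C * (normal_density (u 1) \<sigma> \<theta> * g \<theta>)) \<partial>lborel)"
    using g0 C(1) by (intro nn_integral_cong) (simp add: ennreal_mult[symmetric] mult_ac)
  also have "\<dots> < \<infinity>"
    using integrable_mult_right[OF int, of C] g0 C(1)
    by (subst nn_integral_eq_integral) auto
  finally show ?thesis .
qed

lemma evidence_finite:
  assumes "i \<in> {1..n}"
  shows "evidence i u < \<infinity>"
  using nn_integral_unnormalized_finite[OF assms, of "\<lambda>_. 1" u] \<sigma>_pos
  by (simp add: evidence_def integrable_normal_density)

text \<open>The integrand is strictly positive and the reference measure is not the zero
  measure.\<close>

lemma evidence_pos: "evidence i u \<noteq> 0"
proof
  let ?P = "\<Pi>\<^sub>M j\<in>{1..n} - {i}. obs_space n"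
  interpret P: sigma_finite_measure ?P
    by (intro product_sigma_finite.sigma_finite product_sigma_finite_obs_space) simp
  interpret L: product_sigma_finite "\<lambda>_::nat. (lborel :: real measure)"
    by (rule product_sigma_finite_lborel)
  interpret O: product_sigma_finite "\<lambda>_::nat. obs_space n"
    by (rule product_sigma_finite_obs_space)
  have "emeasure (obs_space n) (space (obs_space n)) \<noteq> 0"
    unfolding obs_space_def space_PiM by (subst L.emeasure_PiM) auto
  then have "emeasure ?P (space ?P) \<noteq> 0"
    unfolding space_PiM by (subst O.emeasure_PiM) auto
  then have "emeasure (unobserved n i) (space (unobserved n i)) \<noteq> 0"
    unfolding unobserved_def space_pair_measure
    by (subst P.emeasure_pair_measure_Times) (auto simp: ennreal_top_mult)
  moreover assume "evidence i u = 0"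
  then have "AE z in unobserved n i. ennreal (unnormalized i u z) = 0"
    unfolding evidence_def by (subst (asm) nn_integral_0_iff_AE) auto
  then have "AE z in unobserved n i. False"
    using unnormalized_pos by (simp add: ennreal_eq_0_iff not_le[symmetric])
  then have "emeasure (unobserved n i) (space (unobserved n i)) = 0"
    by (simp add: AE_iff_null null_sets_def)
  ultimately show False by contradiction
qed

lemma sets_posterior [measurable_cong]: "sets (posterior n \<sigma> \<tau> i u) = sets (unobserved n i)"
  by (simp add: posterior_eq)

lemma prob_space_posterior:
  assumes "i \<in> {1..n}"
  shows "prob_space (posterior n \<sigma> \<tau> i u)"
proof
  have "emeasure (posterior n \<sigma> \<tau> i u) (space (posterior n \<sigma> \<tau> i u)) =
      (\<integral>\<^sup>+z. ennreal (unnormalized i u z) / evidence i u \<partial>unobserved n i)"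
    by (simp add: posterior_eq emeasure_density cong: nn_integral_cong_simp)
  also have "\<dots> = evidence i u / evidence i u"
    unfolding evidence_def[of i u] by (intro nn_integral_divide) simp
  also have "\<dots> = 1"
    using evidence_finite[OF assms, of u] evidence_pos[of i u] by (intro ennreal_divide_self) auto
  finally show "emeasure (posterior n \<sigma> \<tau> i u) (space (posterior n \<sigma> \<tau> i u)) = 1" .
qed

text \<open>A non-integrable function would have Bochner integral 0 by default; integrability is
  what allows the constant shift to be split off in \<open>posterior_mean_translate\<close>.\<close>

lemma integrable_fst_posterior:
  assumes i: "i \<in> {1..n}"
  shows "integrable (posterior n \<sigma> \<tau> i u) fst"
proof (rule integrableI_bounded)
  have "(\<integral>\<^sup>+z. ennreal (norm (fst z)) \<partial>posterior n \<sigma> \<tau> i u) =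
      (\<integral>\<^sup>+z. ennreal (unnormalized i u z) / evidence i u * ennreal \<bar>fst z\<bar> \<partial>unobserved n i)"
    unfolding posterior_eq by (subst nn_integral_density) simp_all
  also have "\<dots> = (\<integral>\<^sup>+z. ennreal \<bar>fst z\<bar> * ennreal (unnormalized i u z) / evidence i u \<partial>unobserved n i)"
    by (simp add: divide_ennreal_def mult_ac)
  also have "\<dots> = (\<integral>\<^sup>+z. ennreal \<bar>fst z\<bar> * ennreal (unnormalized i u z) \<partial>unobserved n i) / evidence i u"
    by (intro nn_integral_divide) simp
  also have "\<dots> < \<infinity>"
  proof -
    have "integrable lborel (\<lambda>\<theta>. normal_density (u 1) \<sigma> \<theta> * \<bar>\<theta>\<bar>)"
      using integrable_abs[OF integrable_normal_moment_nz_1[OF \<sigma>_pos, of "u 1"]]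
      by (simp add: abs_mult)
    then have "(\<integral>\<^sup>+z. ennreal \<bar>fst z\<bar> * ennreal (unnormalized i u z) \<partial>unobserved n i) < \<infinity>"
      by (intro nn_integral_unnormalized_finite[OF i]) simp_all
    then show ?thesis
      using evidence_pos[of i u] by (simp add: ennreal_divide_eq_top_iff less_top[symmetric])
  qed
  finally show "(\<integral>\<^sup>+z. ennreal (norm (fst z)) \<partial>posterior n \<sigma> \<tau> i u) < \<infinity>" .
qed simp

section \<open>Posteriors of translated observations\<close>

text \<open>The shift preserves the reference measure and multiplies the joint density by a
  constant. The same constant multiplies the evidence and disappears on normalization.\<close>

lemma distr_posterior_shift:
  assumes i: "i \<in> {1..n}"
  shows "distr (posterior n \<sigma> \<tau> i u) (unobserved n i) (posterior_shift i v) =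
    posterior n \<sigma> \<tau> i (translate n v u)"
proof -
  let ?B = "unobserved n i" and ?T = "posterior_shift i v" and ?u' = "translate n v u"
  have inv: "distr ?B ?B ?T = ?B" by (rule distr_translate_profile)
  obtain C where C: "C > 0" "\<And>z. unnormalized i ?u' (?T z) = C * unnormalized i u z"
    using joint_density_translate[OF i, of v u] by (auto simp: unnormalized_def)
  have "evidence i ?u' = (\<integral>\<^sup>+z. ennreal (unnormalized i ?u' z) \<partial>distr ?B ?B ?T)"
    by (simp add: evidence_def inv)
  also have "\<dots> = (\<integral>\<^sup>+z. ennreal (C * unnormalized i u z) \<partial>?B)"
    by (subst nn_integral_distr) (simp_all add: C(2))
  also have "\<dots> = ennreal C * evidence i u"
    using C(1) unnormalized_pos[of i u]
    by (simp add: evidence_def ennreal_mult less_imp_le nn_integral_cmult)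
  finally have ev: "evidence i ?u' = ennreal C * evidence i u" .
  \<comment> \<open>With the evidence a positive real, \<open>C\<close> can be cancelled in the
    extended quotient.\<close>
  obtain r where r: "evidence i u = ennreal r" "r > 0"
    using evidence_finite[OF i, of u] evidence_pos[of i u]
    by (cases "evidence i u") (auto simp: less_le)
  have ratio: "ennreal (unnormalized i ?u' (?T z)) / evidence i ?u' = ennreal (unnormalized i u z) / evidence i u" for z
    using C r unnormalized_pos[of i u z]
    by (simp add: ev ennreal_mult[symmetric] divide_ennreal less_imp_le)
  have "posterior n \<sigma> \<tau> i ?u' = density (distr ?B ?B ?T) (\<lambda>z. ennreal (unnormalized i ?u' z) / evidence i ?u')"
    by (simp add: posterior_eq inv)
  also have "\<dots> = distr (posterior n \<sigma> \<tau> i u) ?B ?T"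
    by (subst density_distr) (simp_all add: ratio posterior_eq)
  finally show ?thesis ..
qed

lemma posterior_mean_translate:
  assumes i: "i \<in> {1..n}"
  shows "posterior_mean n \<sigma> \<tau> i (translate n v u) = posterior_mean n \<sigma> \<tau> i u + wmean v"
proof -
  interpret prob_space "posterior n \<sigma> \<tau> i u" by (rule prob_space_posterior[OF i])
  have "posterior_mean n \<sigma> \<tau> i (translate n v u) = (\<integral>z. fst (posterior_shift i v z) \<partial>posterior n \<sigma> \<tau> i u)"
    unfolding posterior_mean_def distr_posterior_shift[OF i, symmetric]
    by (intro integral_distr) simp_all
  also have "\<dots> = posterior_mean n \<sigma> \<tau> i u + wmean v"
    using integrable_fst_posterior[OF i]
    by (simp add: translate_profile_def posterior_mean_def prob_space)
  finally show ?thesis .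
qed

text \<open>Every observation is a translate of the zero observation, so the posterior mean is a
  constant plus the linear function \<open>wmean\<close>.\<close>

lemma measurable_posterior_mean:
  assumes i: "i \<in> {1..n}"
  shows "posterior_mean n \<sigma> \<tau> i \<in> borel_measurable (obs_space n)"
proof -
  let ?o = "\<lambda>p\<in>{1..n}. 0 :: real"
  have "posterior_mean n \<sigma> \<tau> i y = posterior_mean n \<sigma> \<tau> i ?o + wmean y" if "y \<in> space (obs_space n)" for y
  proof -
    have "translate n y ?o = y"
      using that by (auto simp: translate_def obs_space_def space_PiM PiE_iff extensional_def)
    then show ?thesis using posterior_mean_translate[OF i, of y ?o] by simp
  qed
  moreover have "wmean \<in> borel_measurable (obs_space n)"
  proof -
    have [measurable]: "(\<lambda>y. y p) \<in> borel_measurable (obs_space n)" if "p \<in> {1..n}" for p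
      using measurable_obs_space_component[OF that measurable_ident] by simp
    have "(\<lambda>y. \<Sum>p\<in>{2..n}. y p) \<in> borel_measurable (obs_space n)"
      by (intro borel_measurable_sum) simp
    moreover have "(\<lambda>y. y 1) \<in> borel_measurable (obs_space n)" using n_ge_2 by simp
    ultimately show ?thesis unfolding wmean_def[abs_def] by simp
  qed
  then have "(\<lambda>y. posterior_mean n \<sigma> \<tau> i ?o + wmean y) \<in> borel_measurable (obs_space n)"
    by simp
  ultimately show ?thesis
    by (subst measurable_cong) auto
qed

section \<open>Observations tilted along the kernel of the weighted mean\<close>

text \<open>The \<open>\<epsilon>\<close>-direction lies in the kernel of \<^const>\<open>wmean\<close>.\<close>

definition tilt :: "real \<Rightarrow> real \<Rightarrow> nat \<Rightarrow> real" where
  "tilt \<delta> \<epsilon> p = (if p = 1 then \<delta> - real (n - 1) * \<rho> * \<epsilon> else \<delta> + \<epsilon>)"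

text \<open>The rate at which the tilt \<epsilon> moves the posterior mean of each other
  agent.\<close>

definition \<kappa> :: real where "\<kappa> = \<rho> * (1 - \<rho>) / (1 + real (n - 1) * \<rho>)"

lemma \<kappa>_pos: "\<kappa> > 0"
  unfolding \<kappa>_def using wmean_denom_pos \<rho>_pos \<rho>_less_1 by simp

lemma wmean_tilt: "wmean (tilt \<delta> \<epsilon>) = \<delta>"
proof -
  have "(\<Sum>p\<in>{2..n}. tilt \<delta> \<epsilon> p) = (\<Sum>p\<in>{2..n}. \<delta> + \<epsilon>)"
    by (intro sum.cong) (auto simp: tilt_def)
  then have "(\<Sum>p\<in>{2..n}. tilt \<delta> \<epsilon> p) = real (n - 1) * (\<delta> + \<epsilon>)"
    by simp
  moreover have "tilt \<delta> \<epsilon> 1 = \<delta> - real (n - 1) * \<rho> * \<epsilon>" by (simp add: tilt_def)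
  ultimately have "wmean (tilt \<delta> \<epsilon>) = (\<delta> * (1 + real (n - 1) * \<rho>)) / (1 + real (n - 1) * \<rho>)"
    unfolding wmean_def by (simp only:) (simp add: algebra_simps)
  then show ?thesis using wmean_denom_pos by simp
qed

lemma predicted_tilt:
  assumes i: "i \<in> {1..n}" and k: "k \<in> {1..n} - {i}"
  shows "predicted i (tilt \<delta> \<epsilon>) k = \<delta> + \<rho> * \<epsilon>"
proof -
  obtain p where "p \<in> {2..n}" "k = source i p"
    using bij_betw_source_fixed[OF i] k unfolding bij_betw_def by blast
  then show ?thesis
    using predicted_source[OF i, of p "tilt \<delta> \<epsilon>"] by (simp add: wmean_tilt tilt_def algebra_simps)
qed

text \<open>Seen from \<open>j\<close>, the own signal and \<open>n - 2\<close> others gain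
  \<open>\<rho> * \<epsilon>\<close> while that of \<open>i\<close> loses
  \<open>(n - 1) * \<rho> * \<epsilon>\<close>. With report weight \<rho> the net numerator is
  \<open>\<rho> * (1 - \<rho>) * \<epsilon>\<close>, since one surplus loss remains among the
  reports.\<close>

lemma wmean_predicted_tilt:
  assumes i: "i \<in> {1..n}" and j: "j \<in> {1..n} - {i}"
  shows "wmean (\<lambda>p. predicted i (tilt \<delta> \<epsilon>) (source j p)) = \<delta> + \<kappa> * \<epsilon>"
proof -
  have jN: "j \<in> {1..n}" using j by simp
  have "(\<Sum>p\<in>{2..n}. predicted i (tilt \<delta> \<epsilon>) (source j p)) = (\<Sum>k\<in>{1..n} - {j}. predicted i (tilt \<delta> \<epsilon>) k)"
    by (rule sum.reindex_bij_betw[OF bij_betw_source_fixed[OF jN]])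
  also have "\<dots> = predicted i (tilt \<delta> \<epsilon>) i + (\<Sum>k\<in>{1..n} - {j} - {i}. predicted i (tilt \<delta> \<epsilon>) k)"
    using i j by (intro sum.remove) auto
  also have "(\<Sum>k\<in>{1..n} - {j} - {i}. predicted i (tilt \<delta> \<epsilon>) k) = (\<Sum>k\<in>{1..n} - {j} - {i}. \<delta> + \<rho> * \<epsilon>)"
    by (intro sum.cong refl predicted_tilt[OF i]) auto
  also have "\<dots> = (real n - 2) * (\<delta> + \<rho> * \<epsilon>)"
    using i j n_ge_2 by (simp add: card_Diff_singleton_if of_nat_diff)
  also have "predicted i (tilt \<delta> \<epsilon>) i = \<delta> - (real n - 1) * \<rho> * \<epsilon>"
    using n_ge_2 by (simp add: predicted_own tilt_def of_nat_diff)
  finally have S: "(\<Sum>p\<in>{2..n}. predicted i (tilt \<delta> \<epsilon>) (source j p)) =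
    \<delta> - (real n - 1) * \<rho> * \<epsilon> + (real n - 2) * (\<delta> + \<rho> * \<epsilon>)" .
  have j1: "predicted i (tilt \<delta> \<epsilon>) (source j 1) = \<delta> + \<rho> * \<epsilon>"
    using predicted_tilt[OF i j] by (simp add: source_def)
  have "wmean (\<lambda>p. predicted i (tilt \<delta> \<epsilon>) (source j p)) =
      (\<delta> * (1 + real (n - 1) * \<rho>) + \<rho> * (1 - \<rho>) * \<epsilon>) / (1 + real (n - 1) * \<rho>)"
    unfolding wmean_def S j1 using n_ge_2 by (simp add: of_nat_diff algebra_simps)
  then show ?thesis using wmean_denom_pos by (simp add: \<kappa>_def add_divide_distrib)
qed

section \<open>Limits of the expected number of risky agents and the contradiction\<close>

lemma measurable_threshold:
  assumes j: "j \<in> {1..n} - {i}"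
  shows "(\<lambda>z. of_bool (posterior_mean n \<sigma> \<tau> j (snd z j) + a \<le> b) :: real) \<in> borel_measurable (unobserved n i)"
proof -
  have [measurable]: "(\<lambda>z. posterior_mean n \<sigma> \<tau> j (snd z j)) \<in> borel_measurable (unobserved n i)"
    using j by (intro measurable_compose[OF measurable_unobserved_component measurable_posterior_mean]) simp_all
  show ?thesis unfolding of_bool_def by measurable
qed

text \<open>Moves the dependence on \<epsilon> from the measure to the integrand, so that a limit in
  \<epsilon> can be taken under one fixed posterior.\<close>

lemma expected_others_tilt:
  assumes i: "i \<in> {1..n}"
  shows "expected_others n \<sigma> \<tau> (\<lambda>i u. of_bool (posterior_mean n \<sigma> \<tau> i u \<le> t i)) i (translate n (tilt \<delta> \<epsilon>) u) =
    (\<integral>z. (\<Sum>j\<in>{1..n} - {i}. of_bool (posterior_mean n \<sigma> \<tau> j (snd z j) + \<delta> + \<kappa> * \<epsilon> \<le> t j)) \<partial>posterior n \<sigma> \<tau> i u)"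
proof -
  have m: "(\<lambda>z. (\<Sum>j\<in>{1..n} - {i}. of_bool (posterior_mean n \<sigma> \<tau> j (snd z j) \<le> t j) :: real)) \<in> borel_measurable (unobserved n i)"
    using measurable_threshold[of _ i 0] by (intro borel_measurable_sum) simp
  have "expected_others n \<sigma> \<tau> (\<lambda>i u. of_bool (posterior_mean n \<sigma> \<tau> i u \<le> t i)) i (translate n (tilt \<delta> \<epsilon>) u) =
    (\<integral>z. (\<Sum>j\<in>{1..n} - {i}. of_bool (posterior_mean n \<sigma> \<tau> j (snd (posterior_shift i (tilt \<delta> \<epsilon>) z) j) \<le> t j))
      \<partial>posterior n \<sigma> \<tau> i u)"
    unfolding expected_others_def distr_posterior_shift[OF i, symmetric] of_nat_of_bool
    by (rule integral_distr[OF _ m]) simp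
  also have "\<dots> = (\<integral>z. (\<Sum>j\<in>{1..n} - {i}. of_bool (posterior_mean n \<sigma> \<tau> j (snd z j) + \<delta> + \<kappa> * \<epsilon> \<le> t j)) \<partial>posterior n \<sigma> \<tau> i u)"
    using wmean_predicted_tilt[OF i]
    by (intro Bochner_Integration.integral_cong refl sum.cong)
      (simp add: translate_profile_def posterior_mean_translate add.assoc)
  finally show ?thesis .
qed

text \<open>Dominated convergence with bound \<open>n\<close>. The hypothesis \<open>lim\<close>
  covers both directions: \<open>l = 0\<close> if \<open>e\<close> tends to plus infinity,
  \<open>l = 1\<close> if it tends to minus infinity.\<close>

lemma tendsto_expected_others_tilt:
  assumes i: "i \<in> {1..n}"
    and lim: "\<And>a b. (\<lambda>m. of_bool (a + \<kappa> * e m \<le> b) :: real) \<longlonglongrightarrow> l"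
  shows "(\<lambda>m. expected_others n \<sigma> \<tau> (\<lambda>i u. of_bool (posterior_mean n \<sigma> \<tau> i u \<le> t i)) i
      (translate n (tilt \<delta> (e m)) u)) \<longlonglongrightarrow> real (n - 1) * l"
proof -
  interpret prob_space "posterior n \<sigma> \<tau> i u" by (rule prob_space_posterior[OF i])
  let ?f = "\<lambda>m z. \<Sum>j\<in>{1..n} - {i}. of_bool (posterior_mean n \<sigma> \<tau> j (snd z j) + \<delta> + \<kappa> * e m \<le> t j) :: real"
  have mf: "?f m \<in> borel_measurable (unobserved n i)" for m
    using measurable_threshold[of _ i "\<delta> + \<kappa> * e m"]
    by (intro borel_measurable_sum) (simp add: add.assoc)
  then have mf': "?f m \<in> borel_measurable (posterior n \<sigma> \<tau> i u)" for m
    by (simp only: measurable_cong_sets[OF sets_posterior refl])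
  have "(\<lambda>m. \<integral>z. ?f m z \<partial>posterior n \<sigma> \<tau> i u) \<longlonglongrightarrow> (\<integral>z. real (n - 1) * l \<partial>posterior n \<sigma> \<tau> i u)"
  proof (rule integral_dominated_convergence[where w = "\<lambda>_. real n"])
    show "AE z in posterior n \<sigma> \<tau> i u. (\<lambda>m. ?f m z) \<longlonglongrightarrow> real (n - 1) * l"
    proof (intro AE_I2)
      fix z
      have "(\<lambda>m. ?f m z) \<longlonglongrightarrow> (\<Sum>j\<in>{1..n} - {i}. l)"
        by (intro tendsto_sum lim)
      then show "(\<lambda>m. ?f m z) \<longlonglongrightarrow> real (n - 1) * l" using i by simp
    qed
    show "AE z in posterior n \<sigma> \<tau> i u. norm (?f m z) \<le> real n" for m
    proof (intro AE_I2)
      fix z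
      have "?f m z \<le> (\<Sum>j\<in>{1..n} - {i}. 1)" by (intro sum_mono) simp
      also have "\<dots> \<le> real n" using i by simp
      finally show "norm (?f m z) \<le> real n" by (simp add: sum_nonneg)
    qed
  qed (simp_all only: mf' borel_measurable_const integrable_const)
  then show ?thesis
    by (simp add: expected_others_tilt[OF i] prob_space)
qed

lemma no_threshold_equilibrium:
  "\<not> bayes_nash_equilibrium n \<sigma> \<tau> (\<lambda>i u. of_bool (posterior_mean n \<sigma> \<tau> i u \<le> t i))"
proof
  let ?s = "\<lambda>i u. of_bool (posterior_mean n \<sigma> \<tau> i u \<le> t i) :: nat"
  assume "bayes_nash_equilibrium n \<sigma> \<tau> ?s"
  moreover have i: "1 \<in> {1..n}" using n_ge_2 by simp
  ultimately have br: "best_response n \<sigma> \<tau> 1 (?s 1) ?s"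
    unfolding bayes_nash_equilibrium_def by blast
  \<comment> \<open>The value of \<mu> is never computed: it cancels once \<delta> is chosen
    relative to it.\<close>
  define \<mu> where "\<mu> = posterior_mean n \<sigma> \<tau> 1 (\<lambda>_. 0)"
  let ?u = "\<lambda>\<delta> \<epsilon>. translate n (tilt \<delta> \<epsilon>) (\<lambda>_. 0)"
  have pm: "posterior_mean n \<sigma> \<tau> 1 (?u \<delta> \<epsilon>) = \<mu> + \<delta>" for \<delta> \<epsilon>
    using posterior_mean_translate[OF i] by (simp add: \<mu>_def wmean_tilt)
  have br': "(1 + expected_others n \<sigma> \<tau> ?s 1 (?u \<delta> \<epsilon>) < \<mu> + \<delta> \<longrightarrow> ?s 1 (?u \<delta> \<epsilon>) = 0) \<and>
      (1 + expected_others n \<sigma> \<tau> ?s 1 (?u \<delta> \<epsilon>) > \<mu> + \<delta> \<longrightarrow> ?s 1 (?u \<delta> \<epsilon>) = 1)" for \<delta> \<epsilon>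
    using br translate_in_space[of n "tilt \<delta> \<epsilon>" "\<lambda>_. 0"]
    unfolding best_response_def pm[of \<delta> \<epsilon>, symmetric] by blast
  \<comment> \<open>At or below the threshold the prescribed action is 1, which excludes the strict
    inequality that would force 0. The fact \<open>safe\<close> is the mirror image.\<close>
  have risky: "\<mu> + \<delta> \<le> 1 + expected_others n \<sigma> \<tau> ?s 1 (?u \<delta> \<epsilon>)" if "\<mu> + \<delta> \<le> t 1" for \<delta> \<epsilon>
    using br'[of \<delta> \<epsilon>] that unfolding pm by fastforce
  have safe: "1 + expected_others n \<sigma> \<tau> ?s 1 (?u \<delta> \<epsilon>) \<le> \<mu> + \<delta>" if "\<mu> + \<delta> > t 1" for \<delta> \<epsilon>
    using br'[of \<delta> \<epsilon>] that unfolding pm by fastforce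
  have ex: "\<exists>M. \<forall>m\<ge>M. c < \<kappa> * real m" for c
  proof -
    obtain M where M: "c < real M * \<kappa>" using reals_Archimedean3[OF \<kappa>_pos] by blast
    have "c < \<kappa> * real m" if "m \<ge> M" for m
    proof -
      have "real M * \<kappa> \<le> real m * \<kappa>" using that \<kappa>_pos by simp
      then show ?thesis using M by (simp add: mult.commute)
    qed
    then show ?thesis by blast
  qed
  have "(\<lambda>m. of_bool (a + \<kappa> * real m \<le> b) :: real) \<longlonglongrightarrow> 0" for a b
  proof (rule tendsto_eventually)
    obtain M where "\<forall>m\<ge>M. b - a < \<kappa> * real m" using ex by blast
    then show "\<forall>\<^sub>F m in sequentially. (of_bool (a + \<kappa> * real m \<le> b) :: real) = 0"
      by (intro eventually_sequentiallyI[of M]) force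
  qed
  \<comment> \<open>Exactly at the threshold, growing \<epsilon> makes all others safe in the limit;
    hence \<open>t 1 \<le> 1\<close>.\<close>
  from tendsto_expected_others_tilt[OF i this]
  have "(\<lambda>m. 1 + expected_others n \<sigma> \<tau> ?s 1 (?u (t 1 - \<mu>) (real m))) \<longlonglongrightarrow> 1 + real (n - 1) * 0"
    by (intro tendsto_add tendsto_const)
  then have "\<mu> + (t 1 - \<mu>) \<le> 1 + real (n - 1) * 0"
    by (rule LIMSEQ_le_const) (intro exI allI impI risky, simp)
  moreover
  have "(\<lambda>m. of_bool (a + \<kappa> * (- real m) \<le> b) :: real) \<longlonglongrightarrow> 1" for a b
  proof (rule tendsto_eventually)
    obtain M where "\<forall>m\<ge>M. a - b < \<kappa> * real m" using ex by blast
    then show "\<forall>\<^sub>F m in sequentially. (of_bool (a + \<kappa> * (- real m) \<le> b) :: real) = 1"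
      by (intro eventually_sequentiallyI[of M]) force
  qed
  \<comment> \<open>The offset 1/2 makes agent 1 safe, while all others become risky in the limit.
    It gives \<open>n \<le> t 1 + 1/2 \<le> 3/2\<close>; any positive offset below 1 would
    contradict \<open>n \<ge> 2\<close> as well.\<close>
  from tendsto_expected_others_tilt[OF i this]
  have "(\<lambda>m. 1 + expected_others n \<sigma> \<tau> ?s 1 (?u (t 1 + 1 / 2 - \<mu>) (- real m))) \<longlonglongrightarrow> 1 + real (n - 1) * 1"
    by (intro tendsto_add tendsto_const)
  then have "1 + real (n - 1) * 1 \<le> \<mu> + (t 1 + 1 / 2 - \<mu>)"
    by (rule LIMSEQ_le_const2) (intro exI allI impI safe, simp)
  ultimately show False using n_ge_2 by (simp add: of_nat_diff)
qed

end

theorem theorem1: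
  fixes n :: nat and \<sigma> \<tau> :: real
  assumes "n \<ge> 2" and "\<sigma> > 0" and "\<tau> > 0"
  shows "\<not> (\<exists>t :: nat \<Rightarrow> real. bayes_nash_equilibrium n \<sigma> \<tau>
              (\<lambda>i u. of_bool (posterior_mean n \<sigma> \<tau> i u \<le> t i)))"
proof -
  interpret noisy_sharing n \<sigma> \<tau> using assms by unfold_locales
  show ?thesis using no_threshold_equilibrium by blast
qed

end
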